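(* Let $X\subseteq\mathbb{R}^d$ and $\Omega\subseteq\mathbb{R}^D$ be closed, let $\varphi\in C_0(X\times\Omega)$, let $\nu\in\mathcal{M}(X)$ be a probability measure and let $y\in L^2(\nu)$. With $A,A^*,J,R,J^*,R^*$ as defined in the context, the strong duality equality holds: $$\inf_{\mu\in\mathcal{M}(\Omega)}J(A\mu)+R(\mu)=\sup_{\rho\in\mathcal{M}(X)}-J^*(-\rho)-R^*(A^*\rho).$$ The perturbation function for this problem is given by $$F(\mu,f)=J(A\mu-f)+R(\mu),\qquad \mu\in\mathcal{M}(\Omega),\ f\in\mathcal{F}(X,\Omega).$$
   Context: $C_0$ denotes continuous real functions vanishing at infinity, with the supremum norm. $\mathcal{M}(S)$ is the Banach space of signed, finite, regular Borel (Radon) measures on $S$ with total variation norm $\|\mu\|_{\mathcal{M}(S)}=|\mu|(S)$. Measures pair with $C_0$ functions by integration. For $\mu\in\mathcal{M}(\Omega)$, $(A\mu)(x)=\int_\Omega\varphi(x,w)\,d\mu(w)$ for $x\in X$; for $\rho\in\mathcal{M}(X)$, $(A^*\rho)(w)=\int_X\varphi(x,w)\,d\rho(x)$ for $w\in\Omega$ (so $A\mu\in C_0(X)$, $A^*\rho\in C_0(\Omega)$). $\mathcal{F}(X,\Omega):=\{A\mu\mid\mu\in\mathcal{M}(\Omega)\}$ with norm $\|f\|_{\mathcal{F}(X,\Omega)}=\inf_{f=A\mu}\|\mu\|_{\mathcal{M}(\Omega)}$. $J:\mathcal{F}(X,\Omega)\to\mathbb{R}$, $J(f)=\frac12\|f-y\|_{L^2(\nu)}^2=\frac12\int_X(f(x)-y(x))^2\,d\nu(x)$;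 $R:\mathcal{M}(\Omega)\to\mathbb{R}$, $R(\mu)=\|\mu\|_{\mathcal{M}(\Omega)}$. Convex conjugates (with respect to the pre-dual): for $\rho\in\mathcal{M}(X)$, $J^*(\rho):=\sup_{f\in\mathcal{F}(X,\Omega)}(\langle\rho,f\rangle-J(f))$, and for $g\in C_0(\Omega)$, $R^*(g):=\sup_{\mu\in\mathcal{M}(\Omega)}(\langle\mu,g\rangle-R(\mu))$, both with values in $(-\infty,+\infty]$. Perturbation function (standard convex-analysis terminology): $F(\mu,f)$ is a perturbation function for the problem if $F(\mu,0)$ is the primal objective, $J(A\mu)+R(\mu)$, and the dual objective is $\rho\mapsto-F^*(0,\rho)$, where $F^*(0,\rho)=\sup_{\mu\in\mathcal{M}(\Omega),\,f\in\mathcal{F}(X,\Omega)}(\langle\rho,f\rangle-F(\mu,f))$. *)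

theory Defs
  imports "HOL-Probability.Probability"
begin

(* A signed measure is a countably additive real-valued set function; the value 0 off the
   sigma-algebra makes the representation unique. *)
definition signed_measure_on :: "'a measure \<Rightarrow> ('a set \<Rightarrow> real) \<Rightarrow> bool" where
  "signed_measure_on M \<mu> \<longleftrightarrow>
     (\<forall>E::nat \<Rightarrow> 'a set. range E \<subseteq> sets M \<and> disjoint_family E \<longrightarrow>
        (\<lambda>i. \<mu> (E i)) sums \<mu> (\<Union>i. E i)) \<and>
     (\<forall>E. E \<notin> sets M \<longrightarrow> \<mu> E = 0)"

definition total_variation :: "'a measure \<Rightarrow> ('a set \<Rightarrow> real) \<Rightarrow> 'a set \<Rightarrow> ennreal" where
  "total_variation M \<mu> E =
     (SUP P \<in> {P::nat \<Rightarrow> 'a set. range P \<subseteq> sets M \<and> disjoint_family P \<and> (\<Union>i. P i) = E}.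
        (\<Sum>i. ennreal \<bar>\<mu> (P i)\<bar>))"

(* Jordan decomposition: positive part (|mu| + mu) / 2, negative part (|mu| - mu) / 2. *)
definition jordan_pos :: "'a measure \<Rightarrow> ('a set \<Rightarrow> real) \<Rightarrow> 'a measure" where
  "jordan_pos M \<mu> = measure_of (space M) (sets M)
     (\<lambda>E. ennreal ((enn2real (total_variation M \<mu> E) + \<mu> E) / 2))"

definition jordan_neg :: "'a measure \<Rightarrow> ('a set \<Rightarrow> real) \<Rightarrow> 'a measure" where
  "jordan_neg M \<mu> = measure_of (space M) (sets M)
     (\<lambda>E. ennreal ((enn2real (total_variation M \<mu> E) - \<mu> E) / 2))"

abbreviation borel_on :: "'a::topological_space set \<Rightarrow> 'a measure" where
  "borel_on S \<equiv> restrict_space borel S"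

definition radon_measures :: "'a::topological_space set \<Rightarrow> ('a set \<Rightarrow> real) set" where
  "radon_measures S = {\<mu>.
     signed_measure_on (borel_on S) \<mu> \<and>
     total_variation (borel_on S) \<mu> S < \<infinity> \<and>
     (\<forall>E \<in> sets (borel_on S).
        total_variation (borel_on S) \<mu> E =
          (INF U \<in> {U. E \<subseteq> U \<and> openin (top_of_set S) U}. total_variation (borel_on S) \<mu> U) \<and>
        total_variation (borel_on S) \<mu> E =
          (SUP K \<in> {K. K \<subseteq> E \<and> compact K}. total_variation (borel_on S) \<mu> K))}"

definition tv_norm :: "'a::topological_space set \<Rightarrow> ('a set \<Rightarrow> real) \<Rightarrow> real" where
  "tv_norm S \<mu> = enn2real (total_variation (borel_on S) \<mu> S)"

definition pairing :: "'a::topological_space set \<Rightarrow> ('a set \<Rightarrow> real) \<Rightarrow> ('a \<Rightarrow> real) \<Rightarrow> real" where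
  "pairing S \<mu> f =
     (LINT x|jordan_pos (borel_on S) \<mu>. f x) - (LINT x|jordan_neg (borel_on S) \<mu>. f x)"

(* Only the values on S matter; elements need not be normalised outside S. *)
definition C0 :: "'a::topological_space set \<Rightarrow> ('a \<Rightarrow> real) set" where
  "C0 S = {f. continuous_on S f \<and>
     (\<forall>\<epsilon>>0. \<exists>K. compact K \<and> K \<subseteq> S \<and> (\<forall>x\<in>S - K. \<bar>f x\<bar> < \<epsilon>))}"

(* Functions on X (or Omega) produced by the operators are extended by 0 to the whole space,
   so that equality of functions means equality on X (or Omega). *)
definition A_op ::
  "'a::topological_space set \<Rightarrow> 'b::topological_space set \<Rightarrow> ('a \<times> 'b \<Rightarrow> real) \<Rightarrow>
   ('b set \<Rightarrow> real) \<Rightarrow> 'a \<Rightarrow> real" where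
  "A_op X \<Omega> \<phi> \<mu> = (\<lambda>x. if x \<in> X then pairing \<Omega> \<mu> (\<lambda>w. \<phi> (x, w)) else 0)"

definition A_adj ::
  "'a::topological_space set \<Rightarrow> 'b::topological_space set \<Rightarrow> ('a \<times> 'b \<Rightarrow> real) \<Rightarrow>
   ('a set \<Rightarrow> real) \<Rightarrow> 'b \<Rightarrow> real" where
  "A_adj X \<Omega> \<phi> \<rho> = (\<lambda>w. if w \<in> \<Omega> then pairing X \<rho> (\<lambda>x. \<phi> (x, w)) else 0)"

definition F_space ::
  "'a::topological_space set \<Rightarrow> 'b::topological_space set \<Rightarrow> ('a \<times> 'b \<Rightarrow> real) \<Rightarrow>
   ('a \<Rightarrow> real) set" where
  "F_space X \<Omega> \<phi> = A_op X \<Omega> \<phi> ` radon_measures \<Omega>"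

definition J_fun :: "'a measure \<Rightarrow> ('a \<Rightarrow> real) \<Rightarrow> ('a \<Rightarrow> real) \<Rightarrow> real" where
  "J_fun \<nu> y f = 1/2 * (LINT x|\<nu>. (f x - y x)\<^sup>2)"

definition J_conj ::
  "'a::topological_space set \<Rightarrow> 'b::topological_space set \<Rightarrow> ('a \<times> 'b \<Rightarrow> real) \<Rightarrow>
   'a measure \<Rightarrow> ('a \<Rightarrow> real) \<Rightarrow> ('a set \<Rightarrow> real) \<Rightarrow> ereal" where
  "J_conj X \<Omega> \<phi> \<nu> y \<rho> =
     (SUP f \<in> F_space X \<Omega> \<phi>. ereal (pairing X \<rho> f - J_fun \<nu> y f))"

definition R_conj :: "'b::topological_space set \<Rightarrow> ('b \<Rightarrow> real) \<Rightarrow> ereal" where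
  "R_conj \<Omega> g = (SUP \<mu> \<in> radon_measures \<Omega>. ereal (pairing \<Omega> \<mu> g - tv_norm \<Omega> \<mu>))"

(* F^*(0, rho) for a function F on measures and perturbations *)
definition perturbation_conj ::
  "'a::topological_space set \<Rightarrow> 'b::topological_space set \<Rightarrow> ('a \<times> 'b \<Rightarrow> real) \<Rightarrow>
   (('b set \<Rightarrow> real) \<Rightarrow> ('a \<Rightarrow> real) \<Rightarrow> real) \<Rightarrow> ('a set \<Rightarrow> real) \<Rightarrow> ereal" where
  "perturbation_conj X \<Omega> \<phi> F \<rho> =
     (SUP (\<mu>, f) \<in> radon_measures \<Omega> \<times> F_space X \<Omega> \<phi>. ereal (pairing X \<rho> f - F \<mu> f))"

definition is_perturbation_function ::
  "'a::topological_space set \<Rightarrow> 'b::topological_space set \<Rightarrow> ('a \<times> 'b \<Rightarrow> real) \<Rightarrow>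
   (('b set \<Rightarrow> real) \<Rightarrow> real) \<Rightarrow> (('a set \<Rightarrow> real) \<Rightarrow> ereal) \<Rightarrow>
   (('b set \<Rightarrow> real) \<Rightarrow> ('a \<Rightarrow> real) \<Rightarrow> real) \<Rightarrow> bool" where
  "is_perturbation_function X \<Omega> \<phi> primal dual F \<longleftrightarrow>
     (\<forall>\<mu> \<in> radon_measures \<Omega>. F \<mu> (\<lambda>x. 0) = primal \<mu>) \<and>
     (\<forall>\<rho> \<in> radon_measures X. dual \<rho> = - perturbation_conj X \<Omega> \<phi> F \<rho>)"

end

theory Submission
  imports Defs
begin

text \<open>
  Fubini's theorem turns \<open>\<langle>\<rho>, A \<mu>\<rangle>\<close> into \<open>\<langle>\<mu>, A\<^sup>* \<rho>\<rangle>\<close>, which gives weak duality and splits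
  \<open>F\<^sup>* (0, \<rho>)\<close> into \<open>J\<^sup>* (- \<rho>) + R\<^sup>* (A\<^sup>* \<rho>)\<close>. For the converse no minimiser is needed. Let \<open>\<mu>\<close> be
  optimal up to \<open>\<delta>\<^sup>2\<close> and \<open>r = y - A \<mu>\<close>. Comparing \<open>\<mu>\<close> with \<open>\<mu> + t \<eta>\<close> for a step \<open>t\<close> of order
  \<open>\<delta>\<close> shows that \<open>\<langle>r \<nu>, A \<eta>\<rangle> \<le> (1 + O(\<delta>)) \<parallel>\<eta>\<parallel>\<close> for all \<open>\<eta>\<close>, while shrinking \<open>\<mu>\<close> shows that
  \<open>\<langle>r \<nu>, A \<mu>\<rangle> \<ge> \<parallel>\<mu>\<parallel> - O(\<delta>)\<close>. So \<open>r \<nu>\<close>, scaled by \<open>1 - O(\<delta>)\<close>, is dual feasible, and completing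
  the square shows that its dual value is within \<open>O(\<delta>)\<close> of the primal value.
\<close>

subsection \<open>Total variation of signed measures\<close>

text \<open>\<open>R\<^sup>*\<close> vanishes on the unit ball of the supremum norm and is infinite
  outside it, since a measure that beats its own norm can be scaled up. For an exact minimiser
  \<open>A\<^sup>* (r \<nu>)\<close> lies in that ball; for an approximate one it may miss it by a
  little, and the dual value of the unscaled \<open>r \<nu>\<close> would then be minus infinity.
  This is why the residual is scaled before use. The slack is the square of the step parameter so
  that slack divided by step is still of first order. The obstacle underneath is the pairing: it is
  defined through the Jordan decomposition, which is not linear in the measure. Linearity is
  recovered by showing that integrals of bounded Borel functions depend only on the set function,
  not on the positive measures chosen to represent it.\<close>

lemma signed_measure_on_sums:
  assumes "signed_measure_on M \<mu>" "range E \<subseteq> sets M" "disjoint_family E"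
  shows "(\<lambda>i. \<mu> (E i)) sums \<mu> (\<Union>i. E i)"
  using assms by (auto simp: signed_measure_on_def)

lemma signed_measure_on_notin_sets:
  "signed_measure_on M \<mu> \<Longrightarrow> E \<notin> sets M \<Longrightarrow> \<mu> E = 0"
  by (auto simp: signed_measure_on_def)

text \<open>The definition does not state this value; it follows because the constant family of
  empty sets yields a convergent constant series.\<close>

lemma signed_measure_on_empty:
  assumes "signed_measure_on M \<mu>"
  shows "\<mu> {} = 0"
proof -
  have "(\<lambda>i::nat. \<mu> {}) sums \<mu> (\<Union>i::nat. {})"
    by (rule signed_measure_on_sums[OF assms]) (auto simp: disjoint_family_on_def)
  then have "summable (\<lambda>i::nat. \<mu> {})" by (rule sums_summable)
  then show ?thesis using summable_LIMSEQ_zero[of "\<lambda>i::nat. \<mu> {}"] by (simp add: LIMSEQ_const_iff)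
qed

lemma suminf_ennreal_swap:
  fixes f :: "nat \<Rightarrow> nat \<Rightarrow> ennreal"
  shows "(\<Sum>i. \<Sum>j. f i j) = (\<Sum>j. \<Sum>i. f i j)"
  using nn_integral_suminf[of "\<lambda>i j. f i j" "count_space (UNIV :: nat set)"]
  by (simp add: nn_integral_count_space_nat)

lemma suminf_ennreal_prod_decode:
  fixes f :: "nat \<times> nat \<Rightarrow> ennreal"
  shows "(\<Sum>k. f (prod_decode k)) = (\<Sum>i. \<Sum>j. f (i, j))"
  by (rule suminf_ennreal_2dimen) simp

text \<open>If the absolute series diverges, the right-hand side is infinite. The bound can
  therefore be applied before the variation is known to be finite.\<close>

lemma ennreal_abs_sums_le:
  assumes "f sums (x::real)"
  shows "ennreal \<bar>x\<bar> \<le> (\<Sum>i. ennreal \<bar>f i\<bar>)"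
proof (cases "summable (\<lambda>i. \<bar>f i\<bar>)")
  case True
  then have "\<bar>x\<bar> \<le> (\<Sum>i. \<bar>f i\<bar>)"
    using summable_rabs[OF True] assms by (simp add: sums_iff)
  then show ?thesis
    using True by (simp add: suminf_ennreal2 ennreal_leI)
next
  case False
  then have "(\<Sum>i. ennreal \<bar>f i\<bar>) = \<top>"
    using summable_suminf_not_top[OF abs_ge_zero, of f] by blast
  then show ?thesis by (metis top_greatest)
qed

lemma total_variation_upper:
  assumes "range P \<subseteq> sets M" "disjoint_family P" "(\<Union>i. P i) = E"
  shows "(\<Sum>i. ennreal \<bar>\<mu> (P i)\<bar>) \<le> total_variation M \<mu> E"
  unfolding total_variation_def using assms by (intro SUP_upper) auto

lemma total_variation_leI:
  assumes "\<And>P. range P \<subseteq> sets M \<Longrightarrow> disjoint_family P \<Longrightarrow> (\<Union>i. P i) = E \<Longrightarrow>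
             (\<Sum>i. ennreal \<bar>\<mu> (P i)\<bar>) \<le> b"
  shows "total_variation M \<mu> E \<le> b"
  unfolding total_variation_def using assms by (intro SUP_least) auto

lemma total_variation_empty:
  assumes "signed_measure_on M \<mu>"
  shows "total_variation M \<mu> {} = 0"
proof -
  have "total_variation M \<mu> {} \<le> 0"
    by (rule total_variation_leI) (auto simp: signed_measure_on_empty[OF assms])
  then show ?thesis by simp
qed

text \<open>\<open>total_variation\<close> ranges over partitions indexed by a single natural
  number; a doubly indexed one becomes a competitor by reindexing along
  \<open>prod_decode\<close>.\<close>

lemma total_variation_ge_double:
  assumes P: "range (\<lambda>(i, j). P i j) \<subseteq> sets M"
    and disj: "disjoint_family (\<lambda>(i, j). P i j)" and Un: "(\<Union>i j. P i j) = E"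
  shows "(\<Sum>i. \<Sum>j. ennreal \<bar>\<mu> (P i j :: 'a set)\<bar>) \<le> total_variation M \<mu> E"
proof -
  define R where "R k = (case prod_decode k of (i, j) \<Rightarrow> P i j)" for k :: nat
  have "range R = range (\<lambda>(i, j). P i j)"
  proof -
    have "R = (\<lambda>(i, j). P i j) \<circ> prod_decode" by (auto simp: R_def fun_eq_iff)
    then show ?thesis using surj_prod_decode by (simp only: image_comp[symmetric])
  qed
  moreover have "disjoint_family R"
    unfolding R_def disjoint_family_on_def
  proof (intro ballI impI)
    fix m n :: nat assume "m \<noteq> n"
    then have "prod_decode m \<noteq> prod_decode n" by (simp add: inj_eq[OF inj_prod_decode])
    then show "(case prod_decode m of (i, j) \<Rightarrow> P i j) \<inter> (case prod_decode n of (i, j) \<Rightarrow> P i j) = {}"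
      using disjoint_family_onD[OF disj, of "prod_decode m" "prod_decode n"] by simp
  qed
  moreover have "(\<Union>k. R k) = E"
    using \<open>range R = _\<close> Un by auto
  ultimately have "(\<Sum>k. ennreal \<bar>\<mu> (R k)\<bar>) \<le> total_variation M \<mu> E"
    using P by (intro total_variation_upper) auto
  moreover have "(\<Sum>k. ennreal \<bar>\<mu> (R k)\<bar>) = (\<Sum>i. \<Sum>j. ennreal \<bar>\<mu> (P i j)\<bar>)"
    using suminf_ennreal_prod_decode[of "\<lambda>(i, j). ennreal \<bar>\<mu> (P i j)\<bar>"]
    by (simp add: R_def split_beta)
  ultimately show ?thesis by simp
qed

text \<open>A partition of \<open>A\<close> and a partition of \<open>B\<close> combine into one of
  the union; the two suprema are then taken independently.\<close>

lemma total_variation_superadditive: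
  assumes \<mu>: "signed_measure_on M \<mu>" and sets: "A \<in> sets M" "B \<in> sets M" and AB: "A \<inter> B = {}"
  shows "total_variation M \<mu> A + total_variation M \<mu> B \<le> total_variation M \<mu> (A \<union> B)"
proof -
  define parts where
    "parts E = {P::nat \<Rightarrow> 'a set. range P \<subseteq> sets M \<and> disjoint_family P \<and> (\<Union>i. P i) = E}" for E
  define v where "v P = (\<Sum>i. ennreal \<bar>\<mu> (P i)\<bar>)" for P :: "nat \<Rightarrow> 'a set"
  have tv: "total_variation M \<mu> E = (SUP P \<in> parts E. v P)" for E
    by (simp add: total_variation_def parts_def v_def)
  have le: "v P + v Q \<le> total_variation M \<mu> (A \<union> B)" if P: "P \<in> parts A" and Q: "Q \<in> parts B" for P Q
  proof -
    \<comment> \<open>The rows are \<open>P\<close>, \<open>Q\<close> and then only empty sets, so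
      the double sum collapses to the two rows that matter.\<close>
    define R where "R i = (if i = 0 then P else if i = (1::nat) then Q else (\<lambda>_. {}))" for i
    have R01: "R 0 = P" "R (Suc 0) = Q" by (auto simp: R_def)
    have "(\<Sum>i. \<Sum>j. ennreal \<bar>\<mu> (R i j)\<bar>) \<le> total_variation M \<mu> (A \<union> B)"
    proof (rule total_variation_ge_double)
      show "range (\<lambda>(i, j). R i j) \<subseteq> sets M" using P Q by (auto simp: R_def parts_def)
      have RA: "R 0 j \<subseteq> A" "R 1 j \<subseteq> B" for j using P Q by (auto simp: R_def parts_def)
      have same: "R i j \<inter> R i k = {}" if "j \<noteq> k" for i j k
        using that P Q by (auto simp: R_def parts_def disjoint_family_on_def)
      have diff: "R i j \<inter> R i' k = {}" if "i \<noteq> i'" for i i' j k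
      proof (cases "i \<le> 1 \<and> i' \<le> 1")
        case True
        then have "i = 0 \<and> i' = 1 \<or> i = 1 \<and> i' = 0" using that by linarith
        then show ?thesis using RA(1)[of j] RA(2)[of k] RA(1)[of k] RA(2)[of j] AB by blast
      qed (auto simp: R_def)
      show "disjoint_family (\<lambda>(i, j). R i j)"
        unfolding disjoint_family_on_def
      proof (intro ballI impI)
        fix p q :: "nat \<times> nat" assume "p \<noteq> q"
        then show "(case p of (i, j) \<Rightarrow> R i j) \<inter> (case q of (i, j) \<Rightarrow> R i j) = {}"
          using same[of "snd p" "snd q" "fst p"] diff[of "fst p" "fst q" "snd p" "snd q"]
          by (cases "fst p = fst q") (simp_all add: split_beta prod_eq_iff)
      qed
      have "(\<Union>i j. R i j) = (\<Union>j. P j) \<union> (\<Union>j. Q j)"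
      proof (intro antisym subsetI)
        fix x assume "x \<in> (\<Union>j. P j) \<union> (\<Union>j. Q j)"
        then have "(\<exists>j. x \<in> R 0 j) \<or> (\<exists>j. x \<in> R 1 j)" by (auto simp: R_def)
        then show "x \<in> (\<Union>i j. R i j)" by blast
      qed (auto simp: R_def split: if_splits)
      then show "(\<Union>i j. R i j) = A \<union> B" using P Q by (simp add: parts_def)
    qed
    moreover have "(\<Sum>i. \<Sum>j. ennreal \<bar>\<mu> (R i j)\<bar>) = (\<Sum>i\<in>{0, 1}. \<Sum>j. ennreal \<bar>\<mu> (R i j)\<bar>)"
    proof (rule suminf_finite)
      fix i :: nat assume "i \<notin> {0, 1}"
      then have "R i j = {}" for j by (simp add: R_def)
      then show "(\<Sum>j. ennreal \<bar>\<mu> (R i j)\<bar>) = 0" by (simp add: signed_measure_on_empty[OF \<mu>])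
    qed simp
    moreover have "(\<Sum>i\<in>{0, 1}. \<Sum>j. ennreal \<bar>\<mu> (R i j)\<bar>) = v P + v Q"
      using R01 by (simp add: v_def del: sums_ennreal suminf_ennreal)
    ultimately show ?thesis by metis
  qed
  have "parts E \<noteq> {}" if "E \<in> sets M" for E
  proof -
    have "(\<Union>i::nat. if i = 0 then E else {}) = E" by (auto split: if_splits)
    then have "(\<lambda>i. if i = 0 then E else {}) \<in> parts E"
      using that by (simp add: parts_def disjoint_family_on_def image_subset_iff)
    then show ?thesis by blast
  qed
  then have ne: "parts A \<noteq> {}" "parts B \<noteq> {}" using sets by auto
  have "total_variation M \<mu> A + total_variation M \<mu> B = (SUP P \<in> parts A. SUP Q \<in> parts B. v P + v Q)"
    by (simp only: tv ennreal_SUP_add_left[OF ne(1), symmetric] ennreal_SUP_add_right[OF ne(2), symmetric])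
  also have "\<dots> \<le> total_variation M \<mu> (A \<union> B)"
    using le by (intro SUP_least) auto
  finally show ?thesis .
qed

lemma total_variation_mono:
  assumes "signed_measure_on M \<mu>" "A \<in> sets M" "B \<in> sets M" "A \<subseteq> B"
  shows "total_variation M \<mu> A \<le> total_variation M \<mu> B"
proof -
  have "total_variation M \<mu> A + total_variation M \<mu> (B - A) \<le> total_variation M \<mu> (A \<union> (B - A))"
    using assms by (intro total_variation_superadditive) auto
  moreover have "A \<union> (B - A) = B" using assms by auto
  ultimately show ?thesis by (metis add_increasing2 le_iff_add order.trans)
qed

lemma total_variation_ge_abs:
  assumes "signed_measure_on M \<mu>"
  shows "ennreal \<bar>\<mu> E\<bar> \<le> total_variation M \<mu> E"
proof (cases "E \<in> sets M")
  case True
  define P where "P i = (if i = (0::nat) then E else {})" for i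
  have "(\<Sum>i. ennreal \<bar>\<mu> (P i)\<bar>) \<le> total_variation M \<mu> E"
    using True by (intro total_variation_upper) (auto simp: P_def disjoint_family_on_def split: if_splits)
  moreover have "(\<Sum>i. ennreal \<bar>\<mu> (P i)\<bar>) = (\<Sum>i\<in>{0}. ennreal \<bar>\<mu> (P i)\<bar>)"
    by (rule suminf_finite) (auto simp: P_def signed_measure_on_empty[OF assms])
  ultimately show ?thesis by (simp add: P_def)
qed (simp add: signed_measure_on_notin_sets[OF assms])

text \<open>One inequality is superadditivity for finitely many sets followed by a limit. For the
  other, a partition of the union is refined by the sets \<open>E i\<close>, the triangle inequality
  is applied to each piece, and the order of summation is exchanged.\<close>

lemma total_variation_countably_additive:
  assumes \<mu>: "signed_measure_on M \<mu>"
    and E: "range E \<subseteq> sets M" "disjoint_family E"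
  shows "(\<Sum>i. total_variation M \<mu> (E i)) = total_variation M \<mu> (\<Union>i. E i)"
proof (rule antisym)
  have fin: "(\<Sum>i<n. total_variation M \<mu> (E i)) \<le> total_variation M \<mu> (\<Union>i<n. E i)" for n
  proof (induction n)
    case (Suc n)
    have "(\<Union>i<n. E i) \<inter> E n = {}"
      using disjoint_family_onD[OF E(2), of _ n] by fastforce
    then have "total_variation M \<mu> (\<Union>i<n. E i) + total_variation M \<mu> (E n)
        \<le> total_variation M \<mu> ((\<Union>i<n. E i) \<union> E n)"
      using E(1) by (intro total_variation_superadditive[OF \<mu>]) auto
    also have "(\<Union>i<n. E i) \<union> E n = (\<Union>i<Suc n. E i)" by (auto simp: lessThan_Suc)
    finally have "total_variation M \<mu> (\<Union>i<n. E i) + total_variation M \<mu> (E n)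
        \<le> total_variation M \<mu> (\<Union>i<Suc n. E i)" .
    moreover have "(\<Sum>i<Suc n. total_variation M \<mu> (E i))
        \<le> total_variation M \<mu> (\<Union>i<n. E i) + total_variation M \<mu> (E n)"
      using Suc by (simp add: add_right_mono)
    ultimately show ?case by (rule order.trans[rotated])
  qed simp
  show "(\<Sum>i. total_variation M \<mu> (E i)) \<le> total_variation M \<mu> (\<Union>i. E i)"
  proof (rule suminf_le_const)
    fix n
    have "total_variation M \<mu> (\<Union>i<n. E i) \<le> total_variation M \<mu> (\<Union>i. E i)"
      using E(1) by (intro total_variation_mono[OF \<mu>]) auto
    with fin[of n] show "(\<Sum>i<n. total_variation M \<mu> (E i)) \<le> total_variation M \<mu> (\<Union>i. E i)"
      by (rule order.trans)
  qed simp
next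
  show "total_variation M \<mu> (\<Union>i. E i) \<le> (\<Sum>i. total_variation M \<mu> (E i))"
  proof (rule total_variation_leI)
    fix P :: "nat \<Rightarrow> 'a set"
    assume P: "range P \<subseteq> sets M" "disjoint_family P" "(\<Union>i. P i) = (\<Union>i. E i)"
    have "ennreal \<bar>\<mu> (P j)\<bar> \<le> (\<Sum>i. ennreal \<bar>\<mu> (P j \<inter> E i)\<bar>)" for j
    proof -
      have "(\<lambda>i. \<mu> (P j \<inter> E i)) sums \<mu> (\<Union>i. P j \<inter> E i)"
        using P(1) E by (intro signed_measure_on_sums[OF \<mu>] disjoint_family_subset[OF E(2)]) auto
      also have "(\<Union>i. P j \<inter> E i) = P j" using P(3) by auto
      finally show ?thesis by (rule ennreal_abs_sums_le)
    qed
    then have "(\<Sum>j. ennreal \<bar>\<mu> (P j)\<bar>) \<le> (\<Sum>j. \<Sum>i. ennreal \<bar>\<mu> (P j \<inter> E i)\<bar>)"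
      by (intro suminf_le) auto
    also have "\<dots> = (\<Sum>i. \<Sum>j. ennreal \<bar>\<mu> (P j \<inter> E i)\<bar>)"
      by (rule suminf_ennreal_swap)
    also have "\<dots> \<le> (\<Sum>i. total_variation M \<mu> (E i))"
    proof (intro suminf_le total_variation_upper)
      show "range (\<lambda>j. P j \<inter> E i) \<subseteq> sets M" for i using P(1) E(1) by auto
      show "disjoint_family (\<lambda>j. P j \<inter> E i)" for i by (rule disjoint_family_subset[OF P(2)]) auto
      show "(\<Union>j. P j \<inter> E i) = E i" for i using P(3) by auto
    qed auto
    finally show "(\<Sum>j. ennreal \<bar>\<mu> (P j)\<bar>) \<le> (\<Sum>i. total_variation M \<mu> (E i))" .
  qed
qed

subsection \<open>Jordan decomposition and regularity\<close>

text \<open>\<open>measure_of\<close> takes the prescribed values only if these form a measure, so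
  each real-valued set function used to build one has to pass this check.\<close>

lemma emeasure_measure_of_sums:
  fixes g :: "'a set \<Rightarrow> real"
  assumes nonneg: "\<And>E. E \<in> sets M \<Longrightarrow> 0 \<le> g E" and empty: "g {} = 0"
    and sums: "\<And>E. range E \<subseteq> sets M \<Longrightarrow> disjoint_family E \<Longrightarrow> (\<lambda>i. g (E i)) sums g (\<Union>i. E i)"
    and E: "E \<in> sets M"
  shows "emeasure (measure_of (space M) (sets M) (\<lambda>E. ennreal (g E))) E = ennreal (g E)"
proof (rule emeasure_measure_of_sigma[OF _ _ _ E])
  show "sigma_algebra (space M) (sets M)" by (rule sets.sigma_algebra_axioms)
  show "positive (sets M) (\<lambda>E. ennreal (g E))" by (simp add: positive_def empty)
  show "countably_additive (sets M) (\<lambda>E. ennreal (g E))"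
  proof (rule countably_additiveI)
    fix A :: "nat \<Rightarrow> 'a set"
    assume A: "range A \<subseteq> sets M" "disjoint_family A"
    show "(\<Sum>i. ennreal (g (A i))) = ennreal (g (\<Union>i. A i))"
      using sums[OF A] A(1) by (intro suminf_ennreal_eq nonneg) auto
  qed
qed

context
  fixes M :: "'a measure" and \<mu> :: "'a set \<Rightarrow> real"
  assumes signed: "signed_measure_on M \<mu>" and finite: "total_variation M \<mu> (space M) < \<infinity>"
begin

lemma total_variation_finite: "total_variation M \<mu> E < \<infinity>"
proof (cases "E \<in> sets M")
  case True
  then have "total_variation M \<mu> E \<le> total_variation M \<mu> (space M)"
    by (intro total_variation_mono[OF signed]) (auto dest: sets.sets_into_space)
  with finite show ?thesis by simp
next
  \<comment> \<open>A non-measurable set has no partition into measurable pieces, so its variation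
    is a supremum over the empty set, which is 0.\<close>
  case False
  have "total_variation M \<mu> E \<le> 0"
  proof (rule total_variation_leI)
    fix P :: "nat \<Rightarrow> 'a set" assume "range P \<subseteq> sets M" "(\<Union>i. P i) = E"
    then have "E \<in> sets M" by auto
    with False show "(\<Sum>i. ennreal \<bar>\<mu> (P i)\<bar>) \<le> 0" by simp
  qed
  then show ?thesis by simp
qed

lemma abs_le_total_variation: "\<bar>\<mu> E\<bar> \<le> enn2real (total_variation M \<mu> E)"
proof -
  have "ennreal \<bar>\<mu> E\<bar> \<le> ennreal (enn2real (total_variation M \<mu> E))"
    using total_variation_ge_abs[OF signed, of E] total_variation_finite[of E] by simp
  then show ?thesis by simp
qed

lemma total_variation_sums:
  assumes "range E \<subseteq> sets M" "disjoint_family E"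
  shows "(\<lambda>i. enn2real (total_variation M \<mu> (E i))) sums enn2real (total_variation M \<mu> (\<Union>i. E i))"
proof -
  have "(\<lambda>i. total_variation M \<mu> (E i)) sums total_variation M \<mu> (\<Union>i. E i)"
    using total_variation_countably_additive[OF signed assms] summable_sums[OF summableI]
    by metis
  then have "(\<lambda>i. ennreal (enn2real (total_variation M \<mu> (E i)))) sums
      ennreal (enn2real (total_variation M \<mu> (\<Union>i. E i)))"
    using total_variation_finite by simp
  then show ?thesis
    using sums_ennreal[of "\<lambda>i. enn2real (total_variation M \<mu> (E i))"
        "enn2real (total_variation M \<mu> (\<Union>i. E i))"] by simp
qed

lemma sets_jordan [simp]: "sets (jordan_pos M \<mu>) = sets M" "sets (jordan_neg M \<mu>) = sets M"
  by (simp_all add: jordan_pos_def jordan_neg_def)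

lemma space_jordan [simp]: "space (jordan_pos M \<mu>) = space M" "space (jordan_neg M \<mu>) = space M"
  by (simp_all add: jordan_pos_def jordan_neg_def)

text \<open>Both set functions are nonnegative because the variation dominates the absolute value of
  \<open>\<mu>\<close>, and countably additive as combinations of two countably additive
  ones.\<close>

lemma emeasure_jordan:
  assumes "E \<in> sets M"
  shows "emeasure (jordan_pos M \<mu>) E = ennreal ((enn2real (total_variation M \<mu> E) + \<mu> E) / 2)"
    and "emeasure (jordan_neg M \<mu>) E = ennreal ((enn2real (total_variation M \<mu> E) - \<mu> E) / 2)"
proof -
  have emp: "enn2real (total_variation M \<mu> {}) = 0" "\<mu> {} = 0"
    by (simp_all add: total_variation_empty[OF signed] signed_measure_on_empty[OF signed])
  have le: "- \<mu> E \<le> enn2real (total_variation M \<mu> E)" "\<mu> E \<le> enn2real (total_variation M \<mu> E)" for E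
    using abs_le_total_variation[of E] by auto
  show "emeasure (jordan_pos M \<mu>) E = ennreal ((enn2real (total_variation M \<mu> E) + \<mu> E) / 2)"
    unfolding jordan_pos_def
  proof (rule emeasure_measure_of_sums[OF _ _ _ assms])
    show "0 \<le> (enn2real (total_variation M \<mu> E) + \<mu> E) / 2" for E using le(1)[of E] by simp
  qed (intro sums_divide sums_add total_variation_sums signed_measure_on_sums[OF signed] | simp add: emp)+
  show "emeasure (jordan_neg M \<mu>) E = ennreal ((enn2real (total_variation M \<mu> E) - \<mu> E) / 2)"
    unfolding jordan_neg_def
  proof (rule emeasure_measure_of_sums[OF _ _ _ assms])
    show "0 \<le> (enn2real (total_variation M \<mu> E) - \<mu> E) / 2" for E using le(2)[of E] by simp
  qed (intro sums_divide sums_diff total_variation_sums signed_measure_on_sums[OF signed] | simp add: emp)+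
qed

lemma finite_measure_jordan: "finite_measure (jordan_pos M \<mu>)" "finite_measure (jordan_neg M \<mu>)"
  by (auto intro!: finite_measureI simp: emeasure_jordan)

lemma measure_jordan:
  assumes "E \<in> sets M"
  shows "measure (jordan_pos M \<mu>) E = (enn2real (total_variation M \<mu> E) + \<mu> E) / 2"
    and "measure (jordan_neg M \<mu>) E = (enn2real (total_variation M \<mu> E) - \<mu> E) / 2"
  using abs_le_total_variation[of E] emeasure_jordan[OF assms]
  by (auto simp: measure_def)

end

text \<open>Inner and outer regularity are automatic: transport the variation measure to the whole
  space, where every finite Borel measure is regular.\<close>

lemma radon_measures_iff:
  fixes S :: "'a::{second_countable_topology, complete_space} set"
  assumes S: "S \<in> sets borel"
  shows "\<mu> \<in> radon_measures S \<longleftrightarrow>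
    signed_measure_on (borel_on S) \<mu> \<and> total_variation (borel_on S) \<mu> S < \<infinity>"
proof
  assume *: "signed_measure_on (borel_on S) \<mu> \<and> total_variation (borel_on S) \<mu> S < \<infinity>"
  let ?v = "total_variation (borel_on S) \<mu>"
  have signed: "signed_measure_on (borel_on S) \<mu>" and fin: "?v (space (borel_on S)) < \<infinity>"
    using * by (simp_all add: space_restrict_space)
  have sets_S: "A \<in> sets (borel_on S) \<longleftrightarrow> A \<in> sets borel \<and> A \<subseteq> S" for A
    using S by (auto simp: sets_restrict_space_iff)
  define V where "V = measure_of (space (borel_on S)) (sets (borel_on S)) (\<lambda>E. ennreal (enn2real (?v E)))"
  have sets_V: "sets V = sets (borel_on S)" by (simp add: V_def)
  have V: "emeasure V E = ?v E" if "E \<in> sets (borel_on S)" for E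
  proof -
    have "emeasure V E = ennreal (enn2real (?v E))"
      unfolding V_def using total_variation_sums[OF signed fin] that
      by (intro emeasure_measure_of_sums) (auto simp: total_variation_empty[OF signed])
    then show ?thesis using total_variation_finite[OF signed fin, of E] by simp
  qed
  define D where "D = distr V borel (\<lambda>x. x)"
  have id: "(\<lambda>x. x) \<in> measurable V borel"
    using measurable_cong_sets[OF sets_V refl] measurable_restrict_space1[of "\<lambda>x. x" borel borel S]
    by auto
  have spV: "space V = S" using sets_eq_imp_space_eq[OF sets_V] by (simp add: space_restrict_space)
  have D: "emeasure D E = ?v (E \<inter> S)" if "E \<in> sets borel" for E
  proof -
    have "emeasure D E = emeasure V (E \<inter> S)"
      unfolding D_def using that id by (simp add: emeasure_distr spV)
    then show ?thesis using V[of "E \<inter> S"] that S by (simp add: sets_S)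
  qed
  have D_fin: "emeasure D (space D) \<noteq> \<infinity>"
    using D[of UNIV] fin by (simp add: D_def space_restrict_space)
  have "?v E = (INF U \<in> {U. E \<subseteq> U \<and> openin (top_of_set S) U}. ?v U) \<and>
        ?v E = (SUP K \<in> {K. K \<subseteq> E \<and> compact K}. ?v K)" if E: "E \<in> sets (borel_on S)" for E
  proof
    from E have E': "E \<in> sets borel" "E \<subseteq> S" by (simp_all add: sets_S)
    have "?v E = emeasure D E" using D[OF E'(1)] E'(2) by (simp add: Int_absorb2)
    also have "\<dots> = (INF U \<in> {U. E \<subseteq> U \<and> open U}. emeasure D U)"
      by (rule outer_regular[OF _ D_fin E'(1)]) (simp add: D_def)
    also have "\<dots> = (INF U \<in> {U. E \<subseteq> U \<and> open U}. ?v (U \<inter> S))"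
      by (intro INF_cong refl D) auto
    also have "\<dots> = (INF U \<in> (\<lambda>U. U \<inter> S) ` {U. E \<subseteq> U \<and> open U}. ?v U)"
      by (simp add: image_image)
    also have "(\<lambda>U. U \<inter> S) ` {U. E \<subseteq> U \<and> open U} = {U. E \<subseteq> U \<and> openin (top_of_set S) U}"
      using E'(2) by (auto simp: openin_open image_iff)
    finally show "?v E = (INF U \<in> {U. E \<subseteq> U \<and> openin (top_of_set S) U}. ?v U)" .
    have "?v E = emeasure D E" using D[OF E'(1)] E'(2) by (simp add: Int_absorb2)
    also have "\<dots> = (SUP K \<in> {K. K \<subseteq> E \<and> compact K}. emeasure D K)"
      by (rule inner_regular[OF _ D_fin E'(1)]) (simp add: D_def)
    also have "\<dots> = (SUP K \<in> {K. K \<subseteq> E \<and> compact K}. ?v K)"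
    proof (intro SUP_cong refl)
      fix K assume K: "K \<in> {K. K \<subseteq> E \<and> compact K}"
      then have "K \<inter> S = K" using E'(2) by auto
      with K show "emeasure D K = ?v K" using D[of K] by (simp add: borel_compact)
    qed
    finally show "?v E = (SUP K \<in> {K. K \<subseteq> E \<and> compact K}. ?v K)" .
  qed
  with * show "\<mu> \<in> radon_measures S" unfolding radon_measures_def by blast
qed (simp add: radon_measures_def)

subsection \<open>Pairing of measures and functions\<close>

text \<open>The identity is linear in \<open>f\<close> and holds for indicators by
  \<open>eq\<close>, so it extends to bounded measurable functions by monotone approximation. The
  right-hand side is a finite combination so that one lemma gives both independence of the
  representation and linearity in the measure.\<close>

lemma integral_diff_eq_sum:
  fixes f :: "'a \<Rightarrow> real"
  assumes P: "finite_measure P" "sets P = sets M" and Q: "finite_measure Q" "sets Q = sets M"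
    and N: "\<And>i. i \<in> I \<Longrightarrow> finite_measure (N i)" "\<And>i. i \<in> I \<Longrightarrow> sets (N i) = sets M"
    and eq: "\<And>E. E \<in> sets M \<Longrightarrow> measure P E - measure Q E = (\<Sum>i\<in>I. c i * measure (N i) E)"
    and f: "f \<in> borel_measurable M" and B: "\<And>x. x \<in> space M \<Longrightarrow> \<bar>f x\<bar> \<le> B"
  shows "(LINT x|P. f x) - (LINT x|Q. f x) = (\<Sum>i\<in>I. c i * (LINT x|N i. f x))"
proof -
  define fin where "fin K \<longleftrightarrow> finite_measure K \<and> sets K = sets M" for K :: "'a measure"
  have fin: "fin P" "fin Q" "\<And>i. i \<in> I \<Longrightarrow> fin (N i)" using P Q N by (auto simp: fin_def)
  have sp: "space K = space M" if "fin K" for K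
    using that sets_eq_imp_space_eq unfolding fin_def by blast
  have meas: "g \<in> borel_measurable K" if "fin K" "g \<in> borel_measurable M" for K and g :: "'a \<Rightarrow> real"
    using that by (simp add: fin_def cong: measurable_cong_sets)
  have int: "integrable K g" if "fin K" "g \<in> borel_measurable M" "\<And>x. x \<in> space M \<Longrightarrow> \<bar>g x\<bar> \<le> b"
    for K b and g :: "'a \<Rightarrow> real"
  proof -
    interpret finite_measure K using that(1) by (simp add: fin_def)
    show ?thesis using that sp[OF that(1)] meas[OF that(1,2)]
      by (intro integrable_const_bound[of _ b]) auto
  qed
  define \<Phi> where "\<Phi> g \<longleftrightarrow>
    (LINT x|P. g x) - (LINT x|Q. g x) = (\<Sum>i\<in>I. c i * (LINT x|N i. g x))" for g :: "'a \<Rightarrow> real"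
  have ind: "\<Phi> (indicator E)" if "E \<in> sets M" for E
  proof -
    have "(LINT x|K. indicator E x) = measure K E" if "fin K" for K
      using that \<open>E \<in> sets M\<close> sets.sets_into_space[of E K] by (simp add: fin_def Int_absorb1 Int_commute)
    then show ?thesis using fin eq[OF that] by (simp add: \<Phi>_def)
  qed
  have Phi_add: "\<Phi> (\<lambda>x. g x + h x)"
    if "\<Phi> g" "\<Phi> h" and g: "g \<in> borel_measurable M" "\<And>x. x \<in> space M \<Longrightarrow> \<bar>g x\<bar> \<le> b"
      and h: "h \<in> borel_measurable M" "\<And>x. x \<in> space M \<Longrightarrow> \<bar>h x\<bar> \<le> b'" for g h b b'
  proof -
    have plus: "(LINT x|K. g x + h x) = (LINT x|K. g x) + (LINT x|K. h x)" if "fin K" for K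
      by (intro Bochner_Integration.integral_add int[OF that g] int[OF that h])
    have "(\<Sum>i\<in>I. c i * (LINT x|N i. g x + h x)) =
        (\<Sum>i\<in>I. c i * (LINT x|N i. g x) + c i * (LINT x|N i. h x))"
      by (rule sum.cong) (simp_all only: plus[OF fin(3)] distrib_left)
    then show ?thesis
      using that(1,2) unfolding \<Phi>_def plus[OF fin(1)] plus[OF fin(2)] by (simp only: sum.distrib)
  qed
  have Phi_mult: "\<Phi> (\<lambda>x. a * g x)" if "\<Phi> g" for g a
  proof -
    have "(LINT x|P. a * g x) - (LINT x|Q. a * g x) = a * ((LINT x|P. g x) - (LINT x|Q. g x))"
      by (simp add: algebra_simps)
    also have "\<dots> = (\<Sum>i\<in>I. c i * (LINT x|N i. a * g x))"
      using that by (simp add: \<Phi>_def sum_distrib_left mult.left_commute)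
    finally show ?thesis by (simp add: \<Phi>_def)
  qed
  \<comment> \<open>The bound is quantified inside the claim because the induction rule supplies
    none; nonnegativity and monotonicity pass a bound on to multiples, summands and
    approximants.\<close>
  have nonneg: "\<forall>b. (\<forall>x\<in>space M. u x \<le> b) \<longrightarrow> \<Phi> u"
    if "u \<in> borel_measurable M" "\<And>x. 0 \<le> u x" for u
    using that
  proof (induction u rule: borel_measurable_induct_real)
    case (set A)
    then show ?case using ind by blast
  next
    case (mult u a)
    show ?case
    proof (intro allI impI)
      fix b assume b: "\<forall>x\<in>space M. a * u x \<le> b"
      show "\<Phi> (\<lambda>x. a * u x)"
      proof (cases "a = 0")
        case False
        with mult have "0 < a" by simp
        then have "\<forall>x\<in>space M. u x \<le> b / a" using b by (simp add: pos_le_divide_eq mult.commute)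
        then show ?thesis using mult Phi_mult by blast
      qed (simp add: \<Phi>_def)
    qed
  next
    case (add u v)
    show ?case
    proof (intro allI impI)
      fix b assume b: "\<forall>x\<in>space M. v x + u x \<le> b"
      have "u x \<le> b" "v x \<le> b" if "x \<in> space M" for x
        using b that \<open>0 \<le> u x\<close> \<open>0 \<le> v x\<close> by force+
      then have b': "\<bar>u x\<bar> \<le> b" "\<bar>v x\<bar> \<le> b" "u x \<le> b" "v x \<le> b" if "x \<in> space M" for x
        using that \<open>0 \<le> u x\<close> \<open>0 \<le> v x\<close> by simp_all
      then have "\<Phi> u" "\<Phi> v" using add.IH by blast+
      then show "\<Phi> (\<lambda>x. v x + u x)"
        using add.hyps b' by (intro Phi_add[where b = b and b' = b]) auto
    qed
  next
    case (seq U)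
    show ?case
    proof (intro allI impI)
      fix b assume b: "\<forall>x\<in>space M. u x \<le> b"
      have Ub: "U i x \<le> b" if "x \<in> space M" for i x
      proof -
        have "incseq (\<lambda>i. U i x)" using \<open>incseq U\<close> by (auto simp: incseq_def le_fun_def)
        then have "U i x \<le> u x" using \<open>\<And>x. x \<in> space M \<Longrightarrow> (\<lambda>i. U i x) \<longlonglongrightarrow> u x\<close>[OF that] by (rule incseq_le)
        with b that show ?thesis by force
      qed
      have lim: "(\<lambda>i. LINT x|K. U i x) \<longlonglongrightarrow> (LINT x|K. u x)" if "fin K" for K
      proof (rule integral_dominated_convergence[where w = "\<lambda>_. b"])
        interpret finite_measure K using that by (simp add: fin_def)
        show "integrable K (\<lambda>_. b)" by simp
        show "u \<in> borel_measurable K" "\<And>i. U i \<in> borel_measurable K"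
          by (rule meas[OF that], fact)+
        show "AE x in K. (\<lambda>i. U i x) \<longlonglongrightarrow> u x"
          using \<open>\<And>x. x \<in> space M \<Longrightarrow> (\<lambda>i. U i x) \<longlonglongrightarrow> u x\<close> sp[OF that] by (intro AE_I2) simp
        show "AE x in K. norm (U i x) \<le> b" for i
          using seq(2) Ub sp[OF that] by (intro AE_I2) simp
      qed
      have "\<Phi> (U i)" for i using seq.IH[of i] Ub by blast
      then have "(\<lambda>i. (LINT x|P. U i x) - (LINT x|Q. U i x)) =
          (\<lambda>i. \<Sum>j\<in>I. c j * (LINT x|N j. U i x))"
        by (simp add: \<Phi>_def fun_eq_iff)
      moreover have "(\<lambda>i. (LINT x|P. U i x) - (LINT x|Q. U i x)) \<longlonglongrightarrow> (LINT x|P. u x) - (LINT x|Q. u x)"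
        by (intro tendsto_diff lim fin)
      moreover have "(\<lambda>i. \<Sum>j\<in>I. c j * (LINT x|N j. U i x)) \<longlonglongrightarrow> (\<Sum>j\<in>I. c j * (LINT x|N j. u x))"
        by (intro tendsto_sum tendsto_mult lim fin tendsto_const)
      ultimately show "\<Phi> u" unfolding \<Phi>_def using LIMSEQ_unique by metis
    qed
  qed
  have bd: "\<bar>max 0 (f x)\<bar> \<le> B" "\<bar>- 1 * max 0 (- f x)\<bar> \<le> B" "max 0 (f x) \<le> B" "max 0 (- f x) \<le> B"
    if "x \<in> space M" for x
    using B[OF that] by (auto simp: max_def)
  have m: "(\<lambda>x. max 0 (f x)) \<in> borel_measurable M" "(\<lambda>x. max 0 (- f x)) \<in> borel_measurable M"
    using f by measurable
  have pm: "\<Phi> (\<lambda>x. max 0 (f x))" "\<Phi> (\<lambda>x. max 0 (- f x))"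
    using nonneg[OF m(1)] nonneg[OF m(2)] bd(3,4) by (meson max.cobounded1)+
  \<comment> \<open>Positive part minus negative part, written so that only closure under sums and
    multiples is used.\<close>
  have "\<Phi> (\<lambda>x. max 0 (f x) + (- 1) * max 0 (- f x))"
    using m(2) by (intro Phi_add[OF pm(1) Phi_mult[OF pm(2)] m(1) bd(1) _ bd(2)]) auto
  moreover have "(\<lambda>x. max 0 (f x) + (- 1) * max 0 (- f x)) = f" by (auto simp: fun_eq_iff)
  ultimately show ?thesis by (simp add: \<Phi>_def)
qed

text \<open>The working class of test functions: each is integrable against every finite Borel
  measure on \<open>S\<close>, and the class contains the sections of the kernel and the images of
  \<open>A_op\<close> and \<open>A_adj\<close>.\<close>

definition bounded_borel :: "'a::topological_space set \<Rightarrow> ('a \<Rightarrow> real) \<Rightarrow> bool" where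
  "bounded_borel S f \<longleftrightarrow> f \<in> borel_measurable (borel_on S) \<and> (\<exists>B. \<forall>x\<in>S. \<bar>f x\<bar> \<le> B)"

text \<open>Hides the variation formulas: integral arguments can use two finite measures with
  difference \<open>\<mu>\<close> and total mass equal to the norm.\<close>

lemma radon_measures_jordan:
  assumes "\<mu> \<in> radon_measures S"
  obtains P Q where "finite_measure P" "finite_measure Q"
    "sets P = sets (borel_on S)" "sets Q = sets (borel_on S)"
    "\<And>E. \<mu> E = measure P E - measure Q E" "tv_norm S \<mu> = measure P S + measure Q S"
    "\<And>f. pairing S \<mu> f = (LINT x|P. f x) - (LINT x|Q. f x)"
proof
  have \<mu>: "signed_measure_on (borel_on S) \<mu>" "total_variation (borel_on S) \<mu> (space (borel_on S)) < \<infinity>"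
    using assms by (simp_all add: radon_measures_def space_restrict_space)
  let ?P = "jordan_pos (borel_on S) \<mu>" and ?Q = "jordan_neg (borel_on S) \<mu>"
  show "finite_measure ?P" "finite_measure ?Q" by (rule finite_measure_jordan[OF \<mu>])+
  show sets: "sets ?P = sets (borel_on S)" "sets ?Q = sets (borel_on S)" by (rule sets_jordan[OF \<mu>])+
  show "\<mu> E = measure ?P E - measure ?Q E" for E
  proof (cases "E \<in> sets (borel_on S)")
    case True
    show ?thesis by (simp add: measure_jordan[OF \<mu> True] field_simps)
  next
    case False
    then show ?thesis
      using sets by (simp add: signed_measure_on_notin_sets[OF \<mu>(1)] measure_notin_sets)
  qed
  have "S \<in> sets (borel_on S)"
    using sets.top[of "borel_on S"] by (simp add: space_restrict_space)
  from measure_jordan[OF \<mu> this] show "tv_norm S \<mu> = measure ?P S + measure ?Q S"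
    by (simp add: tv_norm_def field_simps)
  show "pairing S \<mu> f = (LINT x|?P. f x) - (LINT x|?Q. f x)" for f by (simp add: pairing_def)
qed

lemma bounded_borel_integrable:
  assumes "bounded_borel S f" "finite_measure P" "sets P = sets (borel_on S)"
  shows "integrable P f"
proof -
  interpret finite_measure P by fact
  obtain B where B: "\<forall>x\<in>S. \<bar>f x\<bar> \<le> B" using assms(1) by (auto simp: bounded_borel_def)
  have "space P = S" using sets_eq_imp_space_eq[OF assms(3)] by (simp add: space_restrict_space)
  moreover have "f \<in> borel_measurable P"
    using assms(1,3) by (simp add: bounded_borel_def cong: measurable_cong_sets)
  ultimately show ?thesis using B by (intro integrable_const_bound[of _ B]) auto
qed

text \<open>The pairing may be computed from any representation of \<open>\<mu>\<close> by finite
  measures, not just from its Jordan decomposition.\<close>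

lemma pairing_eq_sum:
  assumes \<mu>: "\<mu> \<in> radon_measures S" and f: "bounded_borel S f"
    and N: "\<And>i. i \<in> I \<Longrightarrow> finite_measure (N i)" "\<And>i. i \<in> I \<Longrightarrow> sets (N i) = sets (borel_on S)"
    and eq: "\<And>E. E \<in> sets (borel_on S) \<Longrightarrow> \<mu> E = (\<Sum>i\<in>I. c i * measure (N i) E)"
  shows "pairing S \<mu> f = (\<Sum>i\<in>I. c i * (LINT x|N i. f x))"
proof -
  obtain P Q where PQ: "finite_measure P" "finite_measure Q"
    "sets P = sets (borel_on S)" "sets Q = sets (borel_on S)"
    "\<And>E. \<mu> E = measure P E - measure Q E"
    "\<And>f. pairing S \<mu> f = (LINT x|P. f x) - (LINT x|Q. f x)"
    using radon_measures_jordan[OF \<mu>] by metis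
  obtain B where "\<forall>x\<in>S. \<bar>f x\<bar> \<le> B" using f by (auto simp: bounded_borel_def)
  then show ?thesis
    unfolding PQ(6) using f PQ eq N
    by (intro integral_diff_eq_sum[where M = "borel_on S" and B = B])
      (auto simp: bounded_borel_def space_restrict_space)
qed

section \<open>Linear structure and norm of the space of measures\<close>

lemma signed_measure_on_lincomb:
  assumes "signed_measure_on M \<mu>" "signed_measure_on M \<eta>"
  shows "signed_measure_on M (\<lambda>E. a * \<mu> E + b * \<eta> E)"
  using assms unfolding signed_measure_on_def
  by (auto intro!: sums_add sums_mult)

lemma total_variation_lincomb_le:
  assumes "signed_measure_on M \<mu>" "signed_measure_on M \<eta>"
  shows "total_variation M (\<lambda>E. a * \<mu> E + b * \<eta> E) F \<le>
    ennreal \<bar>a\<bar> * total_variation M \<mu> F + ennreal \<bar>b\<bar> * total_variation M \<eta> F"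
proof (rule total_variation_leI)
  fix P :: "nat \<Rightarrow> 'a set"
  assume P: "range P \<subseteq> sets M" "disjoint_family P" "(\<Union>i. P i) = F"
  have "ennreal \<bar>a * \<mu> (P i) + b * \<eta> (P i)\<bar> \<le>
      ennreal \<bar>a\<bar> * ennreal \<bar>\<mu> (P i)\<bar> + ennreal \<bar>b\<bar> * ennreal \<bar>\<eta> (P i)\<bar>" for i
  proof -
    have "\<bar>a * \<mu> (P i) + b * \<eta> (P i)\<bar> \<le> \<bar>a\<bar> * \<bar>\<mu> (P i)\<bar> + \<bar>b\<bar> * \<bar>\<eta> (P i)\<bar>"
      using abs_triangle_ineq[of "a * \<mu> (P i)" "b * \<eta> (P i)"] by (simp add: abs_mult)
    then show ?thesis by (simp add: ennreal_leI flip: ennreal_mult ennreal_plus)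
  qed
  then have "(\<Sum>i. ennreal \<bar>a * \<mu> (P i) + b * \<eta> (P i)\<bar>) \<le>
      (\<Sum>i. ennreal \<bar>a\<bar> * ennreal \<bar>\<mu> (P i)\<bar> + ennreal \<bar>b\<bar> * ennreal \<bar>\<eta> (P i)\<bar>)"
    by (intro suminf_le summableI)
  also have "\<dots> = ennreal \<bar>a\<bar> * (\<Sum>i. ennreal \<bar>\<mu> (P i)\<bar>) + ennreal \<bar>b\<bar> * (\<Sum>i. ennreal \<bar>\<eta> (P i)\<bar>)"
    by (simp only: suminf_add[OF summableI summableI, symmetric] ennreal_suminf_cmult)
  also have "\<dots> \<le> ennreal \<bar>a\<bar> * total_variation M \<mu> F + ennreal \<bar>b\<bar> * total_variation M \<eta> F"
    by (intro add_mono mult_left_mono total_variation_upper[OF P]) auto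
  finally show "(\<Sum>i. ennreal \<bar>a * \<mu> (P i) + b * \<eta> (P i)\<bar>) \<le>
    ennreal \<bar>a\<bar> * total_variation M \<mu> F + ennreal \<bar>b\<bar> * total_variation M \<eta> F" .
qed

lemma tv_norm_nonneg: "0 \<le> tv_norm S \<mu>"
  by (simp add: tv_norm_def)

context
  fixes S :: "'a::{second_countable_topology, complete_space} set"
  assumes S: "S \<in> sets borel"
begin

text \<open>Linear steps, for measures and for functions alike, all take the shape
  \<open>a * u + b * v\<close>; later terms carry explicit coefficients 1, -1 or 0 so that these
  rules match them syntactically.\<close>

lemma radon_measures_lincomb:
  assumes "\<mu> \<in> radon_measures S" "\<eta> \<in> radon_measures S"
  shows "(\<lambda>E. a * \<mu> E + b * \<eta> E) \<in> radon_measures S" (is "?lc \<in> _")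
    and "tv_norm S (\<lambda>E. a * \<mu> E + b * \<eta> E) \<le> \<bar>a\<bar> * tv_norm S \<mu> + \<bar>b\<bar> * tv_norm S \<eta>"
proof -
  let ?v = "\<lambda>\<mu>. total_variation (borel_on S) \<mu> S"
  have \<mu>: "signed_measure_on (borel_on S) \<mu>" "?v \<mu> < \<infinity>"
    and \<eta>: "signed_measure_on (borel_on S) \<eta>" "?v \<eta> < \<infinity>"
    using assms by (simp_all add: radon_measures_iff[OF S])
  have le: "?v ?lc \<le> ennreal \<bar>a\<bar> * ?v \<mu> + ennreal \<bar>b\<bar> * ?v \<eta>"
    by (rule total_variation_lincomb_le[OF \<mu>(1) \<eta>(1)])
  have fin: "?v \<mu> = ennreal (tv_norm S \<mu>)" "?v \<eta> = ennreal (tv_norm S \<eta>)"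
    using \<mu>(2) \<eta>(2) by (simp_all add: tv_norm_def)
  have le': "?v ?lc \<le> ennreal (\<bar>a\<bar> * tv_norm S \<mu> + \<bar>b\<bar> * tv_norm S \<eta>)"
    using le by (simp add: fin tv_norm_nonneg ennreal_mult)
  then have "?v ?lc < \<infinity>" by (simp add: le_less_trans[OF _ ennreal_less_top])
  then show "?lc \<in> radon_measures S"
    using signed_measure_on_lincomb[OF \<mu>(1) \<eta>(1)] by (simp add: radon_measures_iff[OF S])
  show "tv_norm S ?lc \<le> \<bar>a\<bar> * tv_norm S \<mu> + \<bar>b\<bar> * tv_norm S \<eta>"
    unfolding tv_norm_def[of S ?lc] by (rule enn2real_leI[OF _ le']) (simp add: tv_norm_nonneg)
qed

text \<open>The source of the concrete elements of the space: the zero measure, and the positive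
  measures whose difference is the dual candidate.\<close>

lemma radon_measures_measure:
  assumes P: "finite_measure P" "sets P = sets (borel_on S)"
  shows "measure P \<in> radon_measures S"
proof -
  interpret finite_measure P by fact
  have "signed_measure_on (borel_on S) (measure P)"
    unfolding signed_measure_on_def P(2)[symmetric]
    using finite_measure_UNION by (simp add: measure_notin_sets)
  moreover have "total_variation (borel_on S) (measure P) S \<le> ennreal (measure P S)"
  proof (rule total_variation_leI)
    fix E :: "nat \<Rightarrow> 'a set"
    assume "range E \<subseteq> sets (borel_on S)" "disjoint_family E" "(\<Union>i. E i) = S"
    then have "(\<lambda>i. measure P (E i)) sums measure P S"
      using finite_measure_UNION[of E] P(2) by simp
    then have "(\<Sum>i. ennreal (measure P (E i))) = ennreal (measure P S)"
      by (intro suminf_ennreal_eq measure_nonneg)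
    then show "(\<Sum>i. ennreal \<bar>measure P (E i)\<bar>) \<le> ennreal (measure P S)"
      by (simp only: abs_of_nonneg[OF measure_nonneg] order_refl)
  qed
  ultimately show ?thesis
    by (simp add: radon_measures_iff[OF S] le_less_trans[OF _ ennreal_less_top])
qed

lemma pairing_measure:
  assumes "finite_measure P" "sets P = sets (borel_on S)" "bounded_borel S f"
  shows "pairing S (measure P) f = (LINT x|P. f x)"
  using pairing_eq_sum[OF radon_measures_measure[OF assms(1,2)] assms(3), of "{()}" "\<lambda>_. P" "\<lambda>_. 1"] assms
  by simp

lemma pairing_lincomb_measure:
  assumes \<mu>: "\<mu> \<in> radon_measures S" and \<eta>: "\<eta> \<in> radon_measures S" and f: "bounded_borel S f"
  shows "pairing S (\<lambda>E. a * \<mu> E + b * \<eta> E) f = a * pairing S \<mu> f + b * pairing S \<eta> f"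
proof -
  obtain P Q where PQ: "finite_measure P" "finite_measure Q"
    "sets P = sets (borel_on S)" "sets Q = sets (borel_on S)"
    "\<And>E. \<mu> E = measure P E - measure Q E"
    "\<And>f. pairing S \<mu> f = (LINT x|P. f x) - (LINT x|Q. f x)"
    using radon_measures_jordan[OF \<mu>] by metis
  obtain P' Q' where PQ': "finite_measure P'" "finite_measure Q'"
    "sets P' = sets (borel_on S)" "sets Q' = sets (borel_on S)"
    "\<And>E. \<eta> E = measure P' E - measure Q' E"
    "\<And>f. pairing S \<eta> f = (LINT x|P'. f x) - (LINT x|Q'. f x)"
    using radon_measures_jordan[OF \<eta>] by metis
  \<comment> \<open>The Jordan parts of the combination are not combinations of the Jordan parts, so
    the combination is represented by all four measures with signed coefficients.\<close>
  define N where "N i = [P, Q, P', Q'] ! i" for i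
  define c where "c i = [a, - a, b, - b] ! i" for i
  have all4: "{..<4::nat} = {0, 1, 2, 3}" by auto
  have "pairing S (\<lambda>E. a * \<mu> E + b * \<eta> E) f = (\<Sum>i<4. c i * (LINT x|N i. f x))"
  proof (rule pairing_eq_sum[OF radon_measures_lincomb(1)[OF \<mu> \<eta>] f])
    show "finite_measure (N i)" "sets (N i) = sets (borel_on S)" if "i \<in> {..<4}" for i
      using that PQ PQ' unfolding all4 by (auto simp: N_def)
    show "a * \<mu> E + b * \<eta> E = (\<Sum>i<4. c i * measure (N i) E)" for E
      unfolding all4 by (simp add: N_def c_def PQ(5) PQ'(5) algebra_simps)
  qed
  also have "\<dots> = a * pairing S \<mu> f + b * pairing S \<eta> f"
    unfolding all4 by (simp add: N_def c_def PQ(6) PQ'(6) algebra_simps)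
  finally show ?thesis .
qed

end

lemma pairing_lincomb_function:
  assumes "\<mu> \<in> radon_measures S" "bounded_borel S f" "bounded_borel S g"
  shows "pairing S \<mu> (\<lambda>x. a * f x + b * g x) = a * pairing S \<mu> f + b * pairing S \<mu> g"
proof -
  obtain P Q where PQ: "finite_measure P" "finite_measure Q"
    "sets P = sets (borel_on S)" "sets Q = sets (borel_on S)"
    "\<And>f. pairing S \<mu> f = (LINT x|P. f x) - (LINT x|Q. f x)"
    using radon_measures_jordan[OF assms(1)] by metis
  have "integrable P f" "integrable P g" "integrable Q f" "integrable Q g"
    using assms(2,3) PQ by (auto intro: bounded_borel_integrable)
  then show ?thesis by (simp add: PQ(5) algebra_simps)
qed

lemma pairing_cong:
  assumes "\<mu> \<in> radon_measures S" "\<And>x. x \<in> S \<Longrightarrow> f x = g x"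
  shows "pairing S \<mu> f = pairing S \<mu> g"
proof -
  obtain P Q where PQ: "sets P = sets (borel_on S)" "sets Q = sets (borel_on S)"
    "\<And>f. pairing S \<mu> f = (LINT x|P. f x) - (LINT x|Q. f x)"
    using radon_measures_jordan[OF assms(1)] by metis
  have "space P = S" "space Q = S"
    using sets_eq_imp_space_eq[OF PQ(1)] sets_eq_imp_space_eq[OF PQ(2)]
    by (simp_all add: space_restrict_space)
  then show ?thesis
    unfolding PQ(3) by (intro arg_cong2[where f = minus] Bochner_Integration.integral_cong) (auto simp: assms(2))
qed

text \<open>Each Jordan part contributes at most \<open>B\<close> times its mass, and the two masses
  add up to the norm.\<close>

lemma abs_pairing_le:
  assumes "\<mu> \<in> radon_measures S" "bounded_borel S f" "\<And>x. x \<in> S \<Longrightarrow> \<bar>f x\<bar> \<le> B"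
  shows "\<bar>pairing S \<mu> f\<bar> \<le> B * tv_norm S \<mu>"
proof -
  obtain P Q where PQ: "finite_measure P" "finite_measure Q"
    "sets P = sets (borel_on S)" "sets Q = sets (borel_on S)"
    "tv_norm S \<mu> = measure P S + measure Q S"
    "\<And>f. pairing S \<mu> f = (LINT x|P. f x) - (LINT x|Q. f x)"
    using radon_measures_jordan[OF assms(1)] by metis
  have le: "\<bar>LINT x|K. f x\<bar> \<le> B * measure K S"
    if K: "finite_measure K" "sets K = sets (borel_on S)" for K
  proof -
    interpret finite_measure K by fact
    have sp: "space K = S" using sets_eq_imp_space_eq[OF K(2)] by (simp add: space_restrict_space)
    have "\<bar>LINT x|K. f x\<bar> \<le> (LINT x|K. \<bar>f x\<bar>)" by (rule integral_abs_bound)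
    also have "\<dots> \<le> (LINT x|K. B)"
      using assms(3) sp by (intro integral_mono) (auto intro: bounded_borel_integrable[OF assms(2) K])
    finally show ?thesis by (simp add: sp mult.commute)
  qed
  show ?thesis
    using le[OF PQ(1,3)] le[OF PQ(2,4)] unfolding PQ(5,6) by (simp add: distrib_left)
qed

subsection \<open>Kernel operators\<close>

text \<open>Decay with tolerance 1 leaves a compact set, on which continuity gives a bound.\<close>

lemma C0_bounded:
  assumes "f \<in> C0 S"
  obtains B where "0 \<le> B" "\<And>x. x \<in> S \<Longrightarrow> \<bar>f x\<bar> \<le> B"
proof -
  obtain K where K: "compact K" "K \<subseteq> S" "\<forall>x\<in>S - K. \<bar>f x\<bar> < 1"
    using assms zero_less_one unfolding C0_def by blast
  have "continuous_on K f" using assms K(2) by (auto simp: C0_def intro: continuous_on_subset)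
  then have "bounded (f ` K)" using K(1) by (intro compact_imp_bounded compact_continuous_image)
  then obtain B where B: "\<forall>x\<in>K. \<bar>f x\<bar> \<le> B" by (auto simp: bounded_iff)
  show ?thesis
  proof
    show "\<bar>f x\<bar> \<le> max 1 B" if "x \<in> S" for x
      using K(3)[THEN bspec, of x] B[THEN bspec, of x] that by (cases "x \<in> K") auto
  qed simp
qed

text \<open>Extended by 0 off the closed product, \<phi> is Borel on the whole product space, whose
  Borel sets form the product sigma-algebra by second countability. \<open>M\<close> and
  \<open>N\<close> are arbitrary measures with the right sets, as required for Fubini on Jordan
  parts.\<close>

lemma borel_measurable_pair_borel_on:
  fixes \<phi> :: "'a::second_countable_topology \<times> 'b::second_countable_topology \<Rightarrow> real"
  assumes "closed X" "closed \<Omega>" "continuous_on (X \<times> \<Omega>) \<phi>"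
    and M: "sets M = sets (borel_on X)" "sets N = sets (borel_on \<Omega>)"
  shows "\<phi> \<in> borel_measurable (M \<Otimes>\<^sub>M N)"
proof -
  have sp: "space M = X" "space N = \<Omega>"
    using M[THEN sets_eq_imp_space_eq] by (simp_all add: space_restrict_space)
  have "\<phi> \<in> borel_measurable (restrict_space borel (X \<times> \<Omega>))"
    using assms(3) by (rule borel_measurable_continuous_on_restrict)
  then have ext: "(\<lambda>p. indicator (X \<times> \<Omega>) p *\<^sub>R \<phi> p) \<in> borel_measurable borel"
    using assms(1,2) by (subst (asm) borel_measurable_restrict_space_iff)
      (auto intro: borel_closed closed_Times)
  have id: "(\<lambda>x. x) \<in> measurable M borel" "(\<lambda>x. x) \<in> measurable N borel"
    using measurable_restrict_space1[of "\<lambda>x. x" borel borel]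
    by (auto simp: M cong: measurable_cong_sets)
  have "(\<lambda>p. (fst p, snd p)) \<in> measurable (M \<Otimes>\<^sub>M N) (borel \<Otimes>\<^sub>M borel)"
    using measurable_compose[OF measurable_fst id(1)] measurable_compose[OF measurable_snd id(2)]
    by (rule measurable_Pair)
  then have "(\<lambda>p. p) \<in> measurable (M \<Otimes>\<^sub>M N) borel"
    by (simp add: borel_prod)
  from measurable_compose[OF this ext]
  show ?thesis
    by (rule measurable_cong[THEN iffD1, rotated]) (auto simp: space_pair_measure sp)
qed

text \<open>An explicit bound \<open>C\<close> is kept because later error constants depend on it.
  The assumptions are symmetric in the two spaces, so facts about \<open>A_op\<close> pass to
  \<open>A_adj\<close> through \<open>swap\<close>.\<close>

locale kernel =
  fixes X :: "'a::euclidean_space set" and \<Omega> :: "'b::euclidean_space set"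
    and \<phi> :: "'a \<times> 'b \<Rightarrow> real" and C :: real
  assumes closed: "closed X" "closed \<Omega>" and cont: "continuous_on (X \<times> \<Omega>) \<phi>"
    and C: "0 \<le> C" and bound: "\<And>x w. x \<in> X \<Longrightarrow> w \<in> \<Omega> \<Longrightarrow> \<bar>\<phi> (x, w)\<bar> \<le> C"
begin

lemma sets_X: "X \<in> sets borel" and sets_\<Omega>: "\<Omega> \<in> sets borel"
  using closed by (auto intro: borel_closed)

lemma bounded_borel_kernel:
  shows "x \<in> X \<Longrightarrow> bounded_borel \<Omega> (\<lambda>w. \<phi> (x, w))" and "w \<in> \<Omega> \<Longrightarrow> bounded_borel X (\<lambda>x. \<phi> (x, w))"
proof -
  note m = borel_measurable_pair_borel_on[OF closed cont refl refl]
  show "bounded_borel \<Omega> (\<lambda>w. \<phi> (x, w))" if "x \<in> X"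
    unfolding bounded_borel_def
    using measurable_compose[OF measurable_Pair1' m, of x] bound that by (auto simp: space_restrict_space)
  show "bounded_borel X (\<lambda>x. \<phi> (x, w))" if "w \<in> \<Omega>"
    unfolding bounded_borel_def
    using measurable_compose[OF measurable_Pair2' m, of w] bound that by (auto simp: space_restrict_space)
qed

lemma abs_A_op_le:
  assumes "\<mu> \<in> radon_measures \<Omega>"
  shows "\<bar>A_op X \<Omega> \<phi> \<mu> x\<bar> \<le> C * tv_norm \<Omega> \<mu>"
  using abs_pairing_le[OF assms bounded_borel_kernel(1) bound, of x] C
  by (simp add: A_op_def tv_norm_nonneg)

lemma swap: "kernel \<Omega> X (\<lambda>(w, x). \<phi> (x, w)) C"
proof
  have "continuous_on (\<Omega> \<times> X) (\<phi> \<circ> prod.swap)"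
    by (intro continuous_on_compose continuous_on_swap) (simp add: cont product_swap)
  then show "continuous_on (\<Omega> \<times> X) (\<lambda>(w, x). \<phi> (x, w))"
    by (simp add: o_def prod.swap_def split_beta)
qed (use closed C bound in auto)

lemma A_adj_eq: "A_adj X \<Omega> \<phi> = A_op \<Omega> X (\<lambda>(w, x). \<phi> (x, w))"
  by (simp add: A_adj_def A_op_def fun_eq_iff)

lemma integral_kernel_measurable:
  assumes "finite_measure P" "sets P = sets (borel_on \<Omega>)"
  shows "(\<lambda>x. LINT w|P. \<phi> (x, w)) \<in> borel_measurable (borel_on X)"
proof -
  interpret finite_measure P by fact
  have "case_prod (\<lambda>x w. \<phi> (x, w)) \<in> borel_measurable (borel_on X \<Otimes>\<^sub>M P)"
    using borel_measurable_pair_borel_on[OF closed cont refl assms(2)] by simp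
  then show ?thesis by (rule borel_measurable_lebesgue_integral)
qed

lemma bounded_borel_A_op:
  assumes "\<mu> \<in> radon_measures \<Omega>"
  shows "bounded_borel X (A_op X \<Omega> \<phi> \<mu>)"
proof -
  obtain P Q where PQ: "finite_measure P" "finite_measure Q"
    "sets P = sets (borel_on \<Omega>)" "sets Q = sets (borel_on \<Omega>)"
    "\<And>f. pairing \<Omega> \<mu> f = (LINT x|P. f x) - (LINT x|Q. f x)"
    using radon_measures_jordan[OF assms] by metis
  have "(\<lambda>x. (LINT w|P. \<phi> (x, w)) - (LINT w|Q. \<phi> (x, w))) \<in> borel_measurable (borel_on X)"
    using PQ by (intro borel_measurable_diff integral_kernel_measurable)
  then have "A_op X \<Omega> \<phi> \<mu> \<in> borel_measurable (borel_on X)"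
    by (rule measurable_cong[THEN iffD1, rotated]) (simp add: A_op_def PQ(5) space_restrict_space)
  then show ?thesis
    using abs_A_op_le[OF assms] by (auto simp: bounded_borel_def)
qed

lemma Fubini_kernel:
  assumes P: "finite_measure P" "sets P = sets (borel_on X)"
    and Q: "finite_measure Q" "sets Q = sets (borel_on \<Omega>)"
  shows "(LINT x|P. LINT w|Q. \<phi> (x, w)) = (LINT w|Q. LINT x|P. \<phi> (x, w))"
proof -
  interpret P: finite_measure P by fact
  interpret Q: finite_measure Q by fact
  interpret PQ: pair_sigma_finite P Q ..
  interpret F: finite_measure "P \<Otimes>\<^sub>M Q" by (rule finite_measure_pair_measure) fact+
  have sp: "space P = X" "space Q = \<Omega>"
    using P(2)[THEN sets_eq_imp_space_eq] Q(2)[THEN sets_eq_imp_space_eq]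
    by (simp_all add: space_restrict_space)
  have "integrable (P \<Otimes>\<^sub>M Q) (case_prod (\<lambda>x w. \<phi> (x, w)))"
    using borel_measurable_pair_borel_on[OF closed cont P(2) Q(2)] bound
    by (intro F.integrable_const_bound[of _ C] AE_I2) (auto simp: space_pair_measure sp)
  from PQ.Fubini_integral[OF this] show ?thesis by simp
qed

text \<open>Both sides expand into four iterated integrals, one for each pair of Jordan parts, and
  Fubini applies to each.\<close>

lemma pairing_A_op_eq_pairing_A_adj:
  assumes \<mu>: "\<mu> \<in> radon_measures \<Omega>" and \<rho>: "\<rho> \<in> radon_measures X"
  shows "pairing X \<rho> (A_op X \<Omega> \<phi> \<mu>) = pairing \<Omega> \<mu> (A_adj X \<Omega> \<phi> \<rho>)"
proof -
  obtain P Q where PQ: "finite_measure P" "finite_measure Q"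
    "sets P = sets (borel_on \<Omega>)" "sets Q = sets (borel_on \<Omega>)"
    "\<And>f. pairing \<Omega> \<mu> f = (LINT x|P. f x) - (LINT x|Q. f x)"
    using radon_measures_jordan[OF \<mu>] by metis
  obtain P' Q' where PQ': "finite_measure P'" "finite_measure Q'"
    "sets P' = sets (borel_on X)" "sets Q' = sets (borel_on X)"
    "\<And>f. pairing X \<rho> f = (LINT x|P'. f x) - (LINT x|Q'. f x)"
    using radon_measures_jordan[OF \<rho>] by metis
  interpret sw: kernel \<Omega> X "\<lambda>(w, x). \<phi> (x, w)" C by (rule swap)
  \<comment> \<open>The inner integral is \<open>A_op\<close> of the positive measure
    \<open>K\<close> on \<open>X\<close>, hence bounded. This integrability is what permits
    splitting the outer integral of a difference.\<close>
  have bX: "bounded_borel X (\<lambda>x. LINT w|K. \<phi> (x, w))"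
    if K: "finite_measure K" "sets K = sets (borel_on \<Omega>)" for K
  proof -
    have "bounded_borel X (A_op X \<Omega> \<phi> (measure K))"
      by (rule bounded_borel_A_op[OF radon_measures_measure[OF sets_\<Omega> K]])
    moreover have "A_op X \<Omega> \<phi> (measure K) x = (LINT w|K. \<phi> (x, w))" if "x \<in> X" for x
      using that by (simp add: A_op_def pairing_measure[OF sets_\<Omega> K bounded_borel_kernel(1)])
    ultimately show ?thesis
      using integral_kernel_measurable[OF K] by (auto simp: bounded_borel_def)
  qed
  have b\<Omega>: "bounded_borel \<Omega> (\<lambda>w. LINT x|K. \<phi> (x, w))"
    if K: "finite_measure K" "sets K = sets (borel_on X)" for K
  proof -
    have "bounded_borel \<Omega> (A_adj X \<Omega> \<phi> (measure K))"
      unfolding A_adj_eq by (rule sw.bounded_borel_A_op[OF radon_measures_measure[OF sets_X K]])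
    moreover have "A_adj X \<Omega> \<phi> (measure K) w = (LINT x|K. \<phi> (x, w))" if "w \<in> \<Omega>" for w
      using that by (simp add: A_adj_def pairing_measure[OF sets_X K bounded_borel_kernel(2)])
    ultimately show ?thesis
      using sw.integral_kernel_measurable[OF K] by (auto simp: bounded_borel_def)
  qed
  note i = bounded_borel_integrable[OF bX] bounded_borel_integrable[OF b\<Omega>]
  have "pairing X \<rho> (A_op X \<Omega> \<phi> \<mu>) = pairing X \<rho> (\<lambda>x. (LINT w|P. \<phi> (x, w)) - (LINT w|Q. \<phi> (x, w)))"
    by (rule pairing_cong[OF \<rho>]) (simp add: A_op_def PQ(5))
  also have "\<dots> = (LINT x|P'. LINT w|P. \<phi> (x, w)) - (LINT x|P'. LINT w|Q. \<phi> (x, w))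
     - ((LINT x|Q'. LINT w|P. \<phi> (x, w)) - (LINT x|Q'. LINT w|Q. \<phi> (x, w)))"
    unfolding PQ'(5) using PQ PQ' by (simp add: i)
  also have "\<dots> = (LINT w|P. LINT x|P'. \<phi> (x, w)) - (LINT w|P. LINT x|Q'. \<phi> (x, w))
     - ((LINT w|Q. LINT x|P'. \<phi> (x, w)) - (LINT w|Q. LINT x|Q'. \<phi> (x, w)))"
    using PQ PQ' by (simp add: Fubini_kernel)
  also have "\<dots> = pairing \<Omega> \<mu> (\<lambda>w. (LINT x|P'. \<phi> (x, w)) - (LINT x|Q'. \<phi> (x, w)))"
    unfolding PQ(5) using PQ PQ' by (simp add: i)
  also have "\<dots> = pairing \<Omega> \<mu> (A_adj X \<Omega> \<phi> \<rho>)"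
    by (rule pairing_cong[OF \<mu>]) (simp add: A_adj_def PQ'(5))
  finally show ?thesis .
qed

lemma A_op_lincomb:
  assumes "\<mu> \<in> radon_measures \<Omega>" "\<eta> \<in> radon_measures \<Omega>"
  shows "A_op X \<Omega> \<phi> (\<lambda>E. a * \<mu> E + b * \<eta> E) = (\<lambda>x. a * A_op X \<Omega> \<phi> \<mu> x + b * A_op X \<Omega> \<phi> \<eta> x)"
  using pairing_lincomb_measure[OF sets_\<Omega> assms bounded_borel_kernel(1)]
  by (auto simp: A_op_def fun_eq_iff)

end

subsection \<open>Duality\<close>

locale regression = kernel X \<Omega> \<phi> C + prob_space \<nu>
  for X :: "'a::euclidean_space set" and \<Omega> :: "'b::euclidean_space set" and \<phi> C
    and \<nu> :: "'a measure" +
  fixes y :: "'a \<Rightarrow> real"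
  assumes sets_\<nu>: "sets \<nu> = sets (borel_on X)"
    and y_measurable: "y \<in> borel_measurable \<nu>" and y_square: "integrable \<nu> (\<lambda>x. (y x)\<^sup>2)"
begin

section \<open>Square-integrable functions and their semi-inner product\<close>

definition L2 :: "('a \<Rightarrow> real) \<Rightarrow> bool" where
  "L2 u \<longleftrightarrow> u \<in> borel_measurable \<nu> \<and> integrable \<nu> (\<lambda>x. (u x)\<^sup>2)"

text \<open>Arguments are functions rather than classes modulo null sets, so this form is only
  positive semidefinite.\<close>

definition ip :: "('a \<Rightarrow> real) \<Rightarrow> ('a \<Rightarrow> real) \<Rightarrow> real" where
  "ip u v = (LINT x|\<nu>. u x * v x)"

lemma space_\<nu>: "space \<nu> = X"
  using sets_eq_imp_space_eq[OF sets_\<nu>] by (simp add: space_restrict_space)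

lemma L2_integrable_mult:
  assumes "L2 u" "L2 v"
  shows "integrable \<nu> (\<lambda>x. u x * v x)"
proof (rule Bochner_Integration.integrable_bound)
  show "integrable \<nu> (\<lambda>x. (u x)\<^sup>2 + (v x)\<^sup>2)" using assms by (simp add: L2_def)
  show "(\<lambda>x. u x * v x) \<in> borel_measurable \<nu>" using assms by (auto simp: L2_def)
  have "\<bar>s * t\<bar> \<le> s\<^sup>2 + t\<^sup>2" for s t :: real
    using sum_squares_bound[of "\<bar>s\<bar>" "\<bar>t\<bar>"] abs_ge_zero[of "s * t"] by (simp only: power2_abs abs_mult)
  then show "AE x in \<nu>. norm (u x * v x) \<le> norm ((u x)\<^sup>2 + (v x)\<^sup>2)" by (simp add: abs_mult)
qed

lemma L2_lincomb:
  assumes "L2 u" "L2 v"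
  shows "L2 (\<lambda>x. a * u x + b * v x)"
proof -
  have "integrable \<nu> (\<lambda>x. a\<^sup>2 * (u x)\<^sup>2 + (2 * a * b) * (u x * v x) + b\<^sup>2 * (v x)\<^sup>2)"
    using assms L2_integrable_mult[OF assms] by (simp add: L2_def)
  then have "integrable \<nu> (\<lambda>x. (a * u x + b * v x)\<^sup>2)"
    by (simp add: power2_sum power_mult_distrib mult_ac add_ac)
  then show ?thesis using assms by (auto simp: L2_def)
qed

lemma ip_commute: "ip u v = ip v u"
  by (simp add: ip_def mult.commute)

lemma ip_lincomb:
  assumes "L2 u" "L2 v" "L2 w"
  shows "ip (\<lambda>x. a * u x + b * v x) w = a * ip u w + b * ip v w"
  using L2_integrable_mult[OF assms(1,3)] L2_integrable_mult[OF assms(2,3)]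
  by (simp add: ip_def distrib_right mult.assoc)

lemma ip_lincomb_square:
  assumes "L2 u" "L2 v"
  shows "ip (\<lambda>x. a * u x + b * v x) (\<lambda>x. a * u x + b * v x) =
    a\<^sup>2 * ip u u + 2 * a * b * ip u v + b\<^sup>2 * ip v v"
proof -
  let ?w = "\<lambda>x. a * u x + b * v x"
  have "ip u ?w = a * ip u u + b * ip u v" "ip v ?w = a * ip u v + b * ip v v"
    using ip_lincomb[OF assms assms(1), of a b] ip_lincomb[OF assms assms(2), of a b]
    by (simp_all only: ip_commute[of u ?w] ip_commute[of v ?w] ip_commute[of v u])
  then have "ip ?w ?w = a * (a * ip u u + b * ip u v) + b * (a * ip u v + b * ip v v)"
    using ip_lincomb[OF assms L2_lincomb[OF assms], of a b a b] by (simp only:)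
  then show ?thesis by (simp only: power2_eq_square) (simp add: algebra_simps)
qed

lemma ip_nonneg: "0 \<le> ip u u"
  unfolding ip_def by (rule Bochner_Integration.integral_nonneg) simp

lemma L2_y: "L2 y"
  using y_measurable y_square by (simp add: L2_def)

lemma bounded_borel_measurable: "bounded_borel X f \<Longrightarrow> f \<in> borel_measurable \<nu>"
  by (simp add: bounded_borel_def sets_\<nu> cong: measurable_cong_sets)

lemma L2_bounded_borel:
  assumes "bounded_borel X f"
  shows "L2 f"
proof -
  obtain B where B: "\<forall>x\<in>X. \<bar>f x\<bar> \<le> B" using assms by (auto simp: bounded_borel_def)
  have "\<bar>(f x)\<^sup>2\<bar> \<le> B\<^sup>2" if "x \<in> X" for x
    using B that power_mono[of "\<bar>f x\<bar>" B 2] by simp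
  then show ?thesis
    using bounded_borel_measurable[OF assms]
    by (auto simp: L2_def space_\<nu> intro!: integrable_const_bound[of _ "B\<^sup>2"] AE_I2)
qed

lemma ip_bounded_le:
  assumes "bounded_borel X f" "\<And>x. x \<in> X \<Longrightarrow> \<bar>f x\<bar> \<le> B"
  shows "ip f f \<le> B\<^sup>2"
proof -
  have "f x * f x \<le> B\<^sup>2" if "x \<in> X" for x
    using assms(2)[OF that] power_mono[of "\<bar>f x\<bar>" B 2] by (simp add: power2_eq_square)
  then have "ip f f \<le> (LINT x|\<nu>. B\<^sup>2)"
    unfolding ip_def using L2_integrable_mult[OF L2_bounded_borel L2_bounded_borel] assms(1)
    by (intro integral_mono) (auto simp: space_\<nu>)
  then show ?thesis by (simp add: prob_space)
qed

lemma F_space_bounded_borel: "f \<in> F_space X \<Omega> \<phi> \<Longrightarrow> bounded_borel X f"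
  by (auto simp: F_space_def intro: bounded_borel_A_op)

text \<open>By linearity the difference is the image of a difference of measures. It makes
  \<open>f\<close> and \<open>A \<mu> - f\<close> interchangeable as variables of a
  supremum.\<close>

lemma A_op_diff_F_space:
  assumes "\<mu> \<in> radon_measures \<Omega>" "f \<in> F_space X \<Omega> \<phi>"
  shows "(\<lambda>x. A_op X \<Omega> \<phi> \<mu> x - f x) \<in> F_space X \<Omega> \<phi>"
proof -
  obtain \<eta> where \<eta>: "\<eta> \<in> radon_measures \<Omega>" "f = A_op X \<Omega> \<phi> \<eta>"
    using assms(2) by (auto simp: F_space_def)
  have "A_op X \<Omega> \<phi> (\<lambda>E. 1 * \<mu> E + (- 1) * \<eta> E) = (\<lambda>x. A_op X \<Omega> \<phi> \<mu> x - f x)"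
    unfolding A_op_lincomb[OF assms(1) \<eta>(1)] by (simp add: \<eta>(2))
  from image_eqI[where f = "A_op X \<Omega> \<phi>", OF this[symmetric]] show ?thesis
    using radon_measures_lincomb(1)[OF sets_\<Omega> assms(1) \<eta>(1)] unfolding F_space_def by blast
qed

lemma radon_measures_nonempty: "radon_measures \<Omega> \<noteq> {}"
proof -
  have "finite_measure (null_measure (borel_on \<Omega>))" by (rule finite_measureI) simp
  then have "measure (null_measure (borel_on \<Omega>)) \<in> radon_measures \<Omega>"
    by (rule radon_measures_measure[OF sets_\<Omega>]) simp
  then show ?thesis by blast
qed

lemma pairing_uminus:
  assumes "\<rho> \<in> radon_measures X" "bounded_borel X f"
  shows "pairing X (\<lambda>E. - \<rho> E) f = - pairing X \<rho> f"
  using pairing_lincomb_measure[OF sets_X assms(1,1,2), of "- 1" 0] by simp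

section \<open>Primal and dual values, and the conjugate of the perturbation function\<close>

definition primal :: "('b set \<Rightarrow> real) \<Rightarrow> real" where
  "primal \<mu> = J_fun \<nu> y (A_op X \<Omega> \<phi> \<mu>) + tv_norm \<Omega> \<mu>"

definition dual :: "('a set \<Rightarrow> real) \<Rightarrow> ereal" where
  "dual \<rho> = - J_conj X \<Omega> \<phi> \<nu> y (\<lambda>E. - \<rho> E) - R_conj \<Omega> (A_adj X \<Omega> \<phi> \<rho>)"

lemma J_conj_eq:
  assumes "\<rho> \<in> radon_measures X"
  shows "J_conj X \<Omega> \<phi> \<nu> y (\<lambda>E. - \<rho> E) =
    (SUP f \<in> F_space X \<Omega> \<phi>. ereal (- pairing X \<rho> f - J_fun \<nu> y f))"
  unfolding J_conj_def using pairing_uminus[OF assms F_space_bounded_borel] by (intro SUP_cong) auto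

text \<open>Both suprema run over nonempty sets of finite values. This is what makes extended real
  arithmetic with the conjugates safe.\<close>

lemma conj_not_MInfty:
  shows "J_conj X \<Omega> \<phi> \<nu> y \<rho> \<noteq> - \<infinity>" and "R_conj \<Omega> g \<noteq> - \<infinity>"
proof -
  obtain \<mu> where \<mu>: "\<mu> \<in> radon_measures \<Omega>" using radon_measures_nonempty by blast
  then have "A_op X \<Omega> \<phi> \<mu> \<in> F_space X \<Omega> \<phi>" by (simp add: F_space_def)
  then have "ereal (pairing X \<rho> (A_op X \<Omega> \<phi> \<mu>) - J_fun \<nu> y (A_op X \<Omega> \<phi> \<mu>)) \<le> J_conj X \<Omega> \<phi> \<nu> y \<rho>"
    unfolding J_conj_def by (rule SUP_upper)
  then show "J_conj X \<Omega> \<phi> \<nu> y \<rho> \<noteq> - \<infinity>" by auto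
  have "ereal (pairing \<Omega> \<mu> g - tv_norm \<Omega> \<mu>) \<le> R_conj \<Omega> g"
    unfolding R_conj_def using \<mu> by (rule SUP_upper)
  then show "R_conj \<Omega> g \<noteq> - \<infinity>" by auto
qed

text \<open>For extended reals \<open>- a - b\<close> and \<open>- (a + b)\<close> can differ when
  opposite infinities meet; here neither \<open>a\<close> nor \<open>b\<close> is minus
  infinity.\<close>

lemma dual_eq: "dual \<rho> = - (J_conj X \<Omega> \<phi> \<nu> y (\<lambda>E. - \<rho> E) + R_conj \<Omega> (A_adj X \<Omega> \<phi> \<rho>))"
  unfolding dual_def
  using conj_not_MInfty(1)[of "\<lambda>E. - \<rho> E"] conj_not_MInfty(2)[of "A_adj X \<Omega> \<phi> \<rho>"]
  by (cases "J_conj X \<Omega> \<phi> \<nu> y (\<lambda>E. - \<rho> E)"; cases "R_conj \<Omega> (A_adj X \<Omega> \<phi> \<rho>)") auto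

lemma pairing_diff_A_op:
  assumes \<rho>: "\<rho> \<in> radon_measures X" and \<mu>: "\<mu> \<in> radon_measures \<Omega>" and g: "g \<in> F_space X \<Omega> \<phi>"
  shows "pairing X \<rho> (\<lambda>x. A_op X \<Omega> \<phi> \<mu> x - g x) = pairing \<Omega> \<mu> (A_adj X \<Omega> \<phi> \<rho>) - pairing X \<rho> g"
  using pairing_lincomb_function[OF \<rho> bounded_borel_A_op[OF \<mu>] F_space_bounded_borel[OF g], of 1 "- 1"]
  by (simp add: pairing_A_op_eq_pairing_A_adj[OF \<mu> \<rho>])

text \<open>The substitution \<open>f = A \<mu> - g\<close> decouples the two suprema.\<close>

lemma perturbation_conj_eq:
  assumes \<rho>: "\<rho> \<in> radon_measures X"
  shows "perturbation_conj X \<Omega> \<phi> (\<lambda>\<mu> f. J_fun \<nu> y (\<lambda>x. A_op X \<Omega> \<phi> \<mu> x - f x) + tv_norm \<Omega> \<mu>) \<rho> =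
    J_conj X \<Omega> \<phi> \<nu> y (\<lambda>E. - \<rho> E) + R_conj \<Omega> (A_adj X \<Omega> \<phi> \<rho>)"
    (is "perturbation_conj X \<Omega> \<phi> ?F \<rho> = ?J + ?R")
proof (rule antisym)
  let ?a = "\<lambda>g. ereal (- pairing X \<rho> g - J_fun \<nu> y g)"
  let ?b = "\<lambda>\<mu>. ereal (pairing \<Omega> \<mu> (A_adj X \<Omega> \<phi> \<rho>) - tv_norm \<Omega> \<mu>)"
  have J: "?J = (SUP g \<in> F_space X \<Omega> \<phi>. ?a g)" and R: "?R = (SUP \<mu> \<in> radon_measures \<Omega>. ?b \<mu>)"
    by (simp_all only: J_conj_eq[OF \<rho>] R_conj_def)
  show "perturbation_conj X \<Omega> \<phi> ?F \<rho> \<le> ?J + ?R"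
    unfolding perturbation_conj_def
  proof (rule SUP_least, clarify)
    fix \<mu> f assume \<mu>: "\<mu> \<in> radon_measures \<Omega>" and f: "f \<in> F_space X \<Omega> \<phi>"
    let ?g = "\<lambda>x. A_op X \<Omega> \<phi> \<mu> x - f x"
    have g: "?g \<in> F_space X \<Omega> \<phi>" by (rule A_op_diff_F_space[OF \<mu> f])
    have "ereal (pairing X \<rho> f - ?F \<mu> f) = ?a ?g + ?b \<mu>"
      by (simp add: pairing_diff_A_op[OF \<rho> \<mu> f])
    also have "\<dots> \<le> ?J + ?R"
      unfolding J R by (rule add_mono[OF SUP_upper[OF g] SUP_upper[OF \<mu>]])
    finally show "ereal (pairing X \<rho> f - ?F \<mu> f) \<le> ?J + ?R" .
  qed
  have ne: "F_space X \<Omega> \<phi> \<noteq> {}" using radon_measures_nonempty by (simp add: F_space_def)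
  \<comment> \<open>Adding a constant commutes with the supremum because the index set is nonempty
    and the constant is not minus infinity.\<close>
  have "?J + ?R = (SUP g \<in> F_space X \<Omega> \<phi>. ?a g + ?R)"
    unfolding J by (rule SUP_ereal_add_left[OF ne conj_not_MInfty(2), symmetric])
  also have "\<dots> = (SUP g \<in> F_space X \<Omega> \<phi>. SUP \<mu> \<in> radon_measures \<Omega>. ?a g + ?b \<mu>)"
    unfolding R by (intro SUP_cong refl SUP_ereal_add_right[OF radon_measures_nonempty, symmetric]) simp
  also have "\<dots> \<le> perturbation_conj X \<Omega> \<phi> ?F \<rho>"
  proof (intro SUP_least)
    fix g \<mu> assume g: "g \<in> F_space X \<Omega> \<phi>" and \<mu>: "\<mu> \<in> radon_measures \<Omega>"
    let ?f = "\<lambda>x. A_op X \<Omega> \<phi> \<mu> x - g x"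
    have f: "?f \<in> F_space X \<Omega> \<phi>" by (rule A_op_diff_F_space[OF \<mu> g])
    have "?a g + ?b \<mu> = ereal (pairing X \<rho> ?f - ?F \<mu> ?f)"
      by (simp add: pairing_diff_A_op[OF \<rho> \<mu> g])
    also have "\<dots> \<le> perturbation_conj X \<Omega> \<phi> ?F \<rho>"
      unfolding perturbation_conj_def using f \<mu>
      by (intro SUP_upper2[of "(\<mu>, ?f)"]) auto
    finally show "?a g + ?b \<mu> \<le> perturbation_conj X \<Omega> \<phi> ?F \<rho>" .
  qed
  finally show "?J + ?R \<le> perturbation_conj X \<Omega> \<phi> ?F \<rho>" .
qed

text \<open>The conjugates are tested at \<open>A \<mu>\<close> and at \<open>\<mu>\<close>; the two
  pairings cancel and leave \<open>- primal \<mu>\<close>.\<close>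

lemma weak_duality:
  assumes \<mu>: "\<mu> \<in> radon_measures \<Omega>" and \<rho>: "\<rho> \<in> radon_measures X"
  shows "dual \<rho> \<le> ereal (primal \<mu>)"
proof -
  have "A_op X \<Omega> \<phi> \<mu> \<in> F_space X \<Omega> \<phi>" using \<mu> by (simp add: F_space_def)
  then have "ereal (- pairing X \<rho> (A_op X \<Omega> \<phi> \<mu>) - J_fun \<nu> y (A_op X \<Omega> \<phi> \<mu>))
      \<le> J_conj X \<Omega> \<phi> \<nu> y (\<lambda>E. - \<rho> E)"
    unfolding J_conj_eq[OF \<rho>] by (rule SUP_upper)
  moreover have "ereal (pairing \<Omega> \<mu> (A_adj X \<Omega> \<phi> \<rho>) - tv_norm \<Omega> \<mu>) \<le> R_conj \<Omega> (A_adj X \<Omega> \<phi> \<rho>)"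
    unfolding R_conj_def using \<mu> by (rule SUP_upper)
  ultimately have "ereal (- primal \<mu>) \<le> J_conj X \<Omega> \<phi> \<nu> y (\<lambda>E. - \<rho> E) + R_conj \<Omega> (A_adj X \<Omega> \<phi> \<rho>)"
    using add_mono by (fastforce simp: primal_def pairing_A_op_eq_pairing_A_adj[OF \<mu> \<rho>])
  then show ?thesis
    unfolding dual_eq using ereal_uminus_le_reorder by fastforce
qed

text \<open>Realises \<open>r \<nu>\<close> as the difference of the measures with densities the
  positive and negative parts of \<open>r\<close>.\<close>

lemma radon_measure_with_density:
  assumes "L2 r"
  obtains \<rho> where "\<rho> \<in> radon_measures X" "\<And>f. bounded_borel X f \<Longrightarrow> pairing X \<rho> f = ip r f"
proof -
  have r: "r \<in> borel_measurable \<nu>" using assms by (auto simp: L2_def)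
  \<comment> \<open>As a product of \<open>r\<close> with the constant 1, which is square-integrable
    for a probability measure.\<close>
  have int: "integrable \<nu> r"
    using L2_integrable_mult[OF assms L2_bounded_borel[of "\<lambda>_. 1"]]
    by (auto simp: bounded_borel_def intro!: exI[of _ 1])
  define D where "D s = density \<nu> (\<lambda>x. ennreal (max 0 (s * r x)))" for s
  have sets_D: "sets (D s) = sets (borel_on X)" for s by (simp add: D_def sets_\<nu>)
  have fin_D: "finite_measure (D s)" for s
  proof (rule finite_measureI)
    have "integrable \<nu> (\<lambda>x. max 0 (s * r x))" using int by simp
    then have "(\<integral>\<^sup>+x. ennreal (max 0 (s * r x)) \<partial>\<nu>) \<noteq> \<infinity>"
      by (subst nn_integral_eq_integral) auto
    then show "emeasure (D s) (space (D s)) \<noteq> \<infinity>"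
      using r by (simp add: D_def emeasure_density cong: nn_integral_cong_simp)
  qed
  have int_D: "(LINT x|D s. f x) = (LINT x|\<nu>. max 0 (s * r x) * f x)"
    if f: "bounded_borel X f" for s f
    unfolding D_def using r bounded_borel_measurable[OF f] by (subst integral_density) auto
  note radon = radon_measures_measure[OF sets_X fin_D sets_D]
  show ?thesis
  proof
    show "(\<lambda>E. 1 * measure (D 1) E + (- 1) * measure (D (- 1)) E) \<in> radon_measures X"
      by (rule radon_measures_lincomb(1)[OF sets_X radon radon])
    fix f assume f: "bounded_borel X f"
    have L2_max: "L2 (\<lambda>x. max 0 (s * r x))" for s
    proof -
      have "integrable \<nu> (\<lambda>x. s\<^sup>2 * (r x)\<^sup>2)" using assms by (simp add: L2_def)
      then have "integrable \<nu> (\<lambda>x. (max 0 (s * r x))\<^sup>2)"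
        by (rule Bochner_Integration.integrable_bound) (use r in \<open>auto simp: max_def power_mult_distrib\<close>)
      then show ?thesis using r by (simp add: L2_def)
    qed
    note int_mult = L2_integrable_mult[OF L2_max L2_bounded_borel[OF f]]
    have "pairing X (\<lambda>E. 1 * measure (D 1) E + (- 1) * measure (D (- 1)) E) f =
        (LINT x|\<nu>. max 0 (1 * r x) * f x) - (LINT x|\<nu>. max 0 (- 1 * r x) * f x)"
      unfolding pairing_lincomb_measure[OF sets_X radon radon f] pairing_measure[OF sets_X fin_D sets_D f]
        int_D[OF f] by simp
    also have "\<dots> = (LINT x|\<nu>. max 0 (1 * r x) * f x - max 0 (- 1 * r x) * f x)"
      by (rule Bochner_Integration.integral_diff[symmetric]; rule int_mult)
    also have "\<dots> = ip r f"
      unfolding ip_def by (intro Bochner_Integration.integral_cong) (auto simp: max_def)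
    finally show "pairing X (\<lambda>E. 1 * measure (D 1) E + (- 1) * measure (D (- 1)) E) f = ip r f" .
  qed
qed

section \<open>Estimates at a near-minimiser and the resulting dual candidate\<close>

lemma J_fun_eq_ip:
  assumes "\<And>x. f x - y x = u x"
  shows "J_fun \<nu> y f = 1/2 * ip u u"
  by (simp add: J_fun_def ip_def assms power2_eq_square)

text \<open>The perturbed residual expands into a square whose quadratic term is controlled by
  \<open>C\<close>. The norm of the combination is left as it is, since the two applications
  estimate it differently.\<close>

lemma primal_lincomb_le:
  assumes \<mu>: "\<mu> \<in> radon_measures \<Omega>" and \<eta>: "\<eta> \<in> radon_measures \<Omega>"
  defines "r \<equiv> \<lambda>x. y x - A_op X \<Omega> \<phi> \<mu> x"
  shows "primal (\<lambda>E. 1 * \<mu> E + t * \<eta> E) \<le> ip r r / 2 - t * ip r (A_op X \<Omega> \<phi> \<eta>)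
      + t\<^sup>2 / 2 * (C * tv_norm \<Omega> \<eta>)\<^sup>2 + tv_norm \<Omega> (\<lambda>E. 1 * \<mu> E + t * \<eta> E)"
proof -
  let ?a = "A_op X \<Omega> \<phi> \<eta>"
  have L2: "L2 r" "L2 ?a"
    using L2_lincomb[OF L2_y L2_bounded_borel[OF bounded_borel_A_op[OF \<mu>]], of 1 "- 1"]
      L2_bounded_borel[OF bounded_borel_A_op[OF \<eta>]] by (simp_all add: r_def)
  have "J_fun \<nu> y (A_op X \<Omega> \<phi> (\<lambda>E. 1 * \<mu> E + t * \<eta> E)) =
      1/2 * ip (\<lambda>x. (- 1) * r x + t * ?a x) (\<lambda>x. (- 1) * r x + t * ?a x)"
    unfolding A_op_lincomb[OF \<mu> \<eta>] by (rule J_fun_eq_ip) (simp add: r_def)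
  also have "\<dots> = ip r r / 2 - t * ip r ?a + t\<^sup>2 / 2 * ip ?a ?a"
    unfolding ip_lincomb_square[OF L2] by (simp add: field_simps)
  also have "\<dots> \<le> ip r r / 2 - t * ip r ?a + t\<^sup>2 / 2 * (C * tv_norm \<Omega> \<eta>)\<^sup>2"
    using ip_bounded_le[OF bounded_borel_A_op[OF \<eta>] abs_A_op_le[OF \<eta>]] by (simp add: mult_left_mono)
  finally show ?thesis by (simp add: primal_def)
qed

lemma primal_eq:
  defines "r \<equiv> \<lambda>\<mu> x. y x - A_op X \<Omega> \<phi> \<mu> x"
  shows "primal \<mu> = ip (r \<mu>) (r \<mu>) / 2 + tv_norm \<Omega> \<mu>"
  by (simp add: primal_def J_fun_def ip_def r_def power2_commute[of "y _"] flip: power2_eq_square)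

text \<open>Near-optimality of \<open>\<mu>\<close>, tested in the direction \<open>\<eta>\<close> with step \<open>\<delta> / \<parallel>\<eta>\<parallel>\<close>.\<close>

lemma near_optimal_direction:
  assumes \<mu>: "\<mu> \<in> radon_measures \<Omega>" and \<eta>: "\<eta> \<in> radon_measures \<Omega>" and \<delta>: "0 < \<delta>"
    and opt: "\<And>\<kappa>. \<kappa> \<in> radon_measures \<Omega> \<Longrightarrow> primal \<mu> < primal \<kappa> + \<delta>\<^sup>2"
  defines "r \<equiv> \<lambda>x. y x - A_op X \<Omega> \<phi> \<mu> x"
  shows "ip r (A_op X \<Omega> \<phi> \<eta>) \<le> (1 + \<delta> * (1 + C\<^sup>2 / 2)) * tv_norm \<Omega> \<eta>"
proof (cases "tv_norm \<Omega> \<eta> = 0")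
  \<comment> \<open>The step \<open>\<delta> / \<parallel>\<eta>\<parallel>\<close> is meaningless
    here, but the bound on \<open>A_op\<close> forces \<open>A \<eta> = 0\<close> and both sides
    vanish.\<close>
  case True
  have "\<bar>A_op X \<Omega> \<phi> \<eta> x\<bar> \<le> 0" for x using abs_A_op_le[OF \<eta>, of x] True by simp
  then show ?thesis by (simp add: ip_def True)
next
  case False
  let ?N = "tv_norm \<Omega> \<eta>" and ?q = "ip r (A_op X \<Omega> \<phi> \<eta>)"
  have N: "0 < ?N" using False tv_norm_nonneg[of \<Omega> \<eta>] by simp
  let ?t = "\<delta> / ?N"
  have t: "0 < ?t" "?t * ?N = \<delta>" using N \<delta> by simp_all
  have "primal \<mu> = ip r r / 2 + tv_norm \<Omega> \<mu>"
    unfolding r_def by (rule primal_eq)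
  moreover have "primal \<mu> < primal (\<lambda>E. 1 * \<mu> E + ?t * \<eta> E) + \<delta>\<^sup>2"
    by (rule opt[OF radon_measures_lincomb(1)[OF sets_\<Omega> \<mu> \<eta>]])
  moreover have "primal (\<lambda>E. 1 * \<mu> E + ?t * \<eta> E) \<le> ip r r / 2 - ?t * ?q
      + ?t\<^sup>2 / 2 * (C * ?N)\<^sup>2 + tv_norm \<Omega> (\<lambda>E. 1 * \<mu> E + ?t * \<eta> E)"
    unfolding r_def by (rule primal_lincomb_le[OF \<mu> \<eta>])
  moreover have "tv_norm \<Omega> (\<lambda>E. 1 * \<mu> E + ?t * \<eta> E) \<le> tv_norm \<Omega> \<mu> + \<delta>"
    using radon_measures_lincomb(2)[OF sets_\<Omega> \<mu> \<eta>, of 1 ?t] N \<delta> by simp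
  moreover have "?t\<^sup>2 / 2 * (C * ?N)\<^sup>2 = C\<^sup>2 / 2 * (?t * ?N)\<^sup>2"
    by (simp only: power_mult_distrib) simp
  \<comment> \<open>The three terms are the slack, the quadratic term and the growth of the norm.
    Division by \<open>?t\<close>, where \<open>\<delta> / ?t\<close> is the norm of \<eta>,
    produces the factor \<open>1 + \<delta> * (1 + C\<^sup>2 / 2)\<close>.\<close>
  ultimately have "?t * ?q \<le> \<delta>\<^sup>2 + C\<^sup>2 / 2 * \<delta>\<^sup>2 + \<delta>"
    unfolding t(2) by linarith
  also have "\<dots> = ?t * ((1 + \<delta> * (1 + C\<^sup>2 / 2)) * ?N)"
    using N by (simp add: power2_eq_square field_simps)
  finally show ?thesis using t(1) by (simp only: mult_le_cancel_left_pos)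
qed

text \<open>Near-optimality of \<open>\<mu>\<close>, tested by shrinking \<open>\<mu>\<close> to \<open>(1 - \<delta>) \<mu>\<close>.\<close>

lemma near_optimal_self:
  assumes \<mu>: "\<mu> \<in> radon_measures \<Omega>" and \<delta>: "0 < \<delta>" "\<delta> \<le> 1"
    and opt: "\<And>\<kappa>. \<kappa> \<in> radon_measures \<Omega> \<Longrightarrow> primal \<mu> < primal \<kappa> + \<delta>\<^sup>2"
  defines "r \<equiv> \<lambda>x. y x - A_op X \<Omega> \<phi> \<mu> x"
  shows "tv_norm \<Omega> \<mu> - \<delta> * (1 + (C * tv_norm \<Omega> \<mu>)\<^sup>2 / 2) \<le> ip r (A_op X \<Omega> \<phi> \<mu>)"
proof -
  let ?N = "tv_norm \<Omega> \<mu>" and ?q = "ip r (A_op X \<Omega> \<phi> \<mu>)"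
  let ?\<kappa> = "\<lambda>E. 1 * \<mu> E + (- \<delta>) * \<mu> E"
  have "primal \<mu> = ip r r / 2 + ?N"
    unfolding r_def by (rule primal_eq)
  moreover have "primal \<mu> < primal ?\<kappa> + \<delta>\<^sup>2"
    by (rule opt[OF radon_measures_lincomb(1)[OF sets_\<Omega> \<mu> \<mu>]])
  moreover have "primal ?\<kappa> \<le> ip r r / 2 - (- \<delta>) * ?q + (- \<delta>)\<^sup>2 / 2 * (C * ?N)\<^sup>2 + tv_norm \<Omega> ?\<kappa>"
    unfolding r_def by (rule primal_lincomb_le[OF \<mu> \<mu>])
  \<comment> \<open>The triangle inequality for \<open>\<mu> + (- \<delta>) \<mu>\<close> would only
    give \<open>1 + \<delta>\<close>. Rewriting as a single multiple gives the decrease, and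
    \<open>\<delta> \<le> 1\<close> keeps the factor nonnegative.\<close>
  moreover have "tv_norm \<Omega> ?\<kappa> \<le> (1 - \<delta>) * ?N"
  proof -
    have "?\<kappa> = (\<lambda>E. (1 - \<delta>) * \<mu> E + 0 * \<mu> E)" by (simp add: fun_eq_iff algebra_simps)
    then show ?thesis
      using radon_measures_lincomb(2)[OF sets_\<Omega> \<mu> \<mu>, of "1 - \<delta>" 0] \<delta>(2) by simp
  qed
  ultimately have "0 \<le> \<delta> * ?q + \<delta>\<^sup>2 / 2 * (C * ?N)\<^sup>2 - \<delta> * ?N + \<delta>\<^sup>2"
    by (simp only: left_diff_distrib power2_minus)
  also have "\<dots> = \<delta> * (?q - (?N - \<delta> * (1 + (C * ?N)\<^sup>2 / 2)))"
    by (simp add: power2_eq_square field_simps)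
  finally have "0 \<le> ?q - (?N - \<delta> * (1 + (C * ?N)\<^sup>2 / 2))"
    using \<delta>(1) by (simp only: zero_le_mult_iff) linarith
  then show ?thesis by simp
qed

text \<open>Here \<open>\<rho> = c r \<nu>\<close>: the hypothesis says \<open>R\<^sup>* (A\<^sup>* \<rho>) \<le> 0\<close>, and completing the square bounds
  \<open>J\<^sup>* (- \<rho>)\<close>.\<close>

lemma dual_residual_ge:
  assumes r: "L2 r" and c: "\<And>\<eta>. \<eta> \<in> radon_measures \<Omega> \<Longrightarrow> c * ip r (A_op X \<Omega> \<phi> \<eta>) \<le> tv_norm \<Omega> \<eta>"
  obtains \<rho> where "\<rho> \<in> radon_measures X" "ereal (c * ip r y - c\<^sup>2 / 2 * ip r r) \<le> dual \<rho>"
proof -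
  let ?r = "\<lambda>x. c * r x + 0 * r x"
  have r': "L2 ?r" by (rule L2_lincomb[OF r r])
  then obtain \<rho> where \<rho>: "\<rho> \<in> radon_measures X"
    and pair: "\<And>f. bounded_borel X f \<Longrightarrow> pairing X \<rho> f = ip ?r f"
    using radon_measure_with_density by blast
  have ip_r: "ip ?r f = c * ip r f" if "L2 f" for f
    using ip_lincomb[OF r r that, of c 0] by simp
  have "J_conj X \<Omega> \<phi> \<nu> y (\<lambda>E. - \<rho> E) \<le> ereal (- (c * ip r y - c\<^sup>2 / 2 * ip r r))"
    unfolding J_conj_eq[OF \<rho>]
  proof (rule SUP_least)
    fix f assume "f \<in> F_space X \<Omega> \<phi>"
    then have f: "bounded_borel X f" by (rule F_space_bounded_borel)
    let ?u = "\<lambda>x. 1 * f x + (- 1) * y x"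
    have u: "L2 ?u" by (rule L2_lincomb[OF L2_bounded_borel[OF f] L2_y])
    \<comment> \<open>The square is centred at \<open>f = y - c r\<close>, the maximiser of
      \<open>- c \<langle>r, f\<rangle> - J f\<close> over all square-integrable functions. It need
      not lie in \<open>F_space\<close>, since only an upper bound is wanted.\<close>
    have "0 \<le> ip (\<lambda>x. 1 * ?u x + c * r x) (\<lambda>x. 1 * ?u x + c * r x)" by (rule ip_nonneg)
    also have "\<dots> = ip ?u ?u + 2 * c * ip r ?u + c\<^sup>2 * ip r r"
      unfolding ip_lincomb_square[OF u r] by (simp only: ip_commute[of ?u r]) simp
    also have "ip r ?u = ip r f - ip r y"
      using ip_lincomb[OF L2_bounded_borel[OF f] L2_y r, of 1 "- 1"]
      by (simp only: ip_commute[of r ?u] ip_commute[of r f] ip_commute[of r y])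
    also have "ip ?u ?u = 2 * J_fun \<nu> y f"
      using J_fun_eq_ip[of f ?u] by simp
    finally have "- (c * ip r f) - J_fun \<nu> y f \<le> - (c * ip r y - c\<^sup>2 / 2 * ip r r)"
      by (simp add: algebra_simps)
    then show "ereal (- pairing X \<rho> f - J_fun \<nu> y f) \<le> ereal (- (c * ip r y - c\<^sup>2 / 2 * ip r r))"
      by (simp only: pair[OF f] ip_r[OF L2_bounded_borel[OF f]] ereal_less_eq)
  qed
  moreover have "R_conj \<Omega> (A_adj X \<Omega> \<phi> \<rho>) \<le> 0"
    unfolding R_conj_def
  proof (rule SUP_least)
    fix \<eta> assume \<eta>: "\<eta> \<in> radon_measures \<Omega>"
    have "pairing \<Omega> \<eta> (A_adj X \<Omega> \<phi> \<rho>) = c * ip r (A_op X \<Omega> \<phi> \<eta>)"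
      using pairing_A_op_eq_pairing_A_adj[OF \<eta> \<rho>] pair[OF bounded_borel_A_op[OF \<eta>]]
        ip_r[OF L2_bounded_borel[OF bounded_borel_A_op[OF \<eta>]]] by simp
    then show "ereal (pairing \<Omega> \<eta> (A_adj X \<Omega> \<phi> \<rho>) - tv_norm \<Omega> \<eta>) \<le> 0"
      using c[OF \<eta>] by simp
  qed
  ultimately have "J_conj X \<Omega> \<phi> \<nu> y (\<lambda>E. - \<rho> E) + R_conj \<Omega> (A_adj X \<Omega> \<phi> \<rho>)
      \<le> ereal (- (c * ip r y - c\<^sup>2 / 2 * ip r r)) + 0"
    by (rule add_mono)
  then have "ereal (c * ip r y - c\<^sup>2 / 2 * ip r r) \<le> dual \<rho>"
    unfolding dual_eq by (subst ereal_minus_le_minus[symmetric]) simp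
  with \<rho> show ?thesis by (rule that)
qed

lemma primal_nonneg: "0 \<le> primal \<mu>"
  by (simp add: primal_def J_fun_def tv_norm_nonneg Bochner_Integration.integral_nonneg)

text \<open>The level \<open>L\<close> bounds the norm of \<mu> by \<open>L\<close> and the squared
  residual by \<open>2 * L\<close>, so the error is \<delta> times a constant independent of \<mu>.
  The two losses from scaling by \<open>c\<close> give \<open>2 * k * L\<close>; the shrinking
  estimate gives \<open>K\<close>.\<close>

lemma near_optimal_dual:
  assumes \<mu>: "\<mu> \<in> radon_measures \<Omega>" and \<delta>: "0 < \<delta>" "\<delta> \<le> 1"
    and opt: "\<And>\<kappa>. \<kappa> \<in> radon_measures \<Omega> \<Longrightarrow> primal \<mu> < primal \<kappa> + \<delta>\<^sup>2"
    and L: "primal \<mu> \<le> L"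
  obtains \<rho> where "\<rho> \<in> radon_measures X"
    "ereal (primal \<mu> - \<delta> * (2 * (1 + C\<^sup>2 / 2) * L + (1 + (C * L)\<^sup>2 / 2))) \<le> dual \<rho>"
proof -
  define r where "r = (\<lambda>x. y x - A_op X \<Omega> \<phi> \<mu> x)"
  define k where "k = 1 + C\<^sup>2 / 2"
  define K where "K = 1 + (C * L)\<^sup>2 / 2"
  \<comment> \<open>Exactly the factor that turns the directional bound
    \<open>(1 + \<delta> * k) \<parallel>\<eta>\<parallel>\<close> into dual feasibility.\<close>
  define c where "c = 1 / (1 + \<delta> * k)"
  let ?N = "tv_norm \<Omega> \<mu>" and ?q = "ip r (A_op X \<Omega> \<phi> \<mu>)" and ?rr = "ip r r"
  have L2: "L2 (A_op X \<Omega> \<phi> \<mu>)" by (rule L2_bounded_borel[OF bounded_borel_A_op[OF \<mu>]])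
  then have r: "L2 r" using L2_lincomb[OF L2_y, of _ 1 "- 1"] by (simp add: r_def)
  have k: "1 \<le> k" by (simp add: k_def)
  then have pos: "0 < 1 + \<delta> * k" using \<delta>(1) by (simp add: add_pos_pos)
  have c: "0 < c" "c \<le> 1" "1 - c \<le> \<delta> * k"
  proof -
    show "0 < c" "c \<le> 1" using pos k \<delta>(1) by (simp_all add: c_def)
    have "1 - c = \<delta> * k * c" using pos by (simp add: c_def field_simps)
    also have "\<dots> \<le> \<delta> * k * 1" using \<open>c \<le> 1\<close> k \<delta>(1) by (intro mult_left_mono) auto
    finally show "1 - c \<le> \<delta> * k" by simp
  qed
  have primal: "primal \<mu> = ?rr / 2 + ?N"
    unfolding r_def by (rule primal_eq)
  then have bounds: "0 \<le> ?N" "?N \<le> L" "0 \<le> ?rr" "?rr \<le> 2 * L"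
    using L tv_norm_nonneg[of \<Omega> \<mu>] ip_nonneg[of r] by linarith+
  have "c * ip r (A_op X \<Omega> \<phi> \<eta>) \<le> tv_norm \<Omega> \<eta>" if "\<eta> \<in> radon_measures \<Omega>" for \<eta>
  proof -
    have "ip r (A_op X \<Omega> \<phi> \<eta>) \<le> (1 + \<delta> * k) * tv_norm \<Omega> \<eta>"
      unfolding r_def k_def by (rule near_optimal_direction[OF \<mu> that \<delta>(1) opt])
    then show ?thesis using pos by (simp add: c_def field_simps)
  qed
  then obtain \<rho> where \<rho>: "\<rho> \<in> radon_measures X" "ereal (c * ip r y - c\<^sup>2 / 2 * ?rr) \<le> dual \<rho>"
    using dual_residual_ge[OF r] by metis
  have "ip r y = ?rr + ?q"
  proof -
    have "(\<lambda>x. 1 * r x + 1 * A_op X \<Omega> \<phi> \<mu> x) = y" by (simp add: r_def)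
    then show ?thesis
      using ip_lincomb[OF r L2 r, of 1 1] by (simp only: ip_commute[of y r] ip_commute[of "A_op X \<Omega> \<phi> \<mu>" r] mult_1)
  qed
  \<comment> \<open>Uses \<open>c - c\<^sup>2 / 2 = 1/2 - (1 - c)\<^sup>2 / 2\<close>, so that the
    residual part is lost only to second order in \<open>1 - c\<close>.\<close>
  then have D: "c * ip r y - c\<^sup>2 / 2 * ?rr = c * ?q + ?rr / 2 - (1 - c)\<^sup>2 / 2 * ?rr"
    by (simp add: power2_eq_square field_simps)
  have "?N - \<delta> * K \<le> ?q"
  proof -
    have "(C * ?N)\<^sup>2 \<le> (C * L)\<^sup>2"
      using bounds C by (intro power_mono mult_left_mono) auto
    then have "\<delta> * (1 + (C * ?N)\<^sup>2 / 2) \<le> \<delta> * K" using \<delta>(1) by (simp add: K_def)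
    moreover have "?N - \<delta> * (1 + (C * ?N)\<^sup>2 / 2) \<le> ?q"
      unfolding r_def by (rule near_optimal_self[OF \<mu> \<delta> opt])
    ultimately show ?thesis by linarith
  qed
  then have "c * (?N - \<delta> * K) \<le> c * ?q" using c(1) by simp
  moreover have "c * (\<delta> * K) \<le> 1 * (\<delta> * K)"
    using c(2) \<delta>(1) by (intro mult_right_mono) (auto simp: K_def)
  moreover have "(1 - c) * ?N \<le> (\<delta> * k) * L"
    using bounds c \<delta>(1) k by (intro mult_mono) auto
  moreover have "(1 - c)\<^sup>2 / 2 * ?rr \<le> (\<delta> * k) / 2 * (2 * L)"
  proof (intro mult_mono divide_right_mono)
    have "(1 - c) * (1 - c) \<le> (1 - c) * 1" using c by (intro mult_left_mono) auto
    then show "(1 - c)\<^sup>2 \<le> \<delta> * k" using c(3) by (simp add: power2_eq_square)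
  qed (use bounds \<delta>(1) k in auto)
  ultimately have "primal \<mu> - \<delta> * (2 * k * L + K) \<le> c * ip r y - c\<^sup>2 / 2 * ?rr"
    unfolding D primal by (simp add: algebra_simps)
  then have "ereal (primal \<mu> - \<delta> * (2 * k * L + K)) \<le> dual \<rho>"
    using \<rho>(2) by (meson ereal_less_eq(3) order.trans)
  with \<rho>(1) show ?thesis unfolding k_def K_def by (rule that)
qed

theorem strong_duality:
  "(INF \<mu> \<in> radon_measures \<Omega>. ereal (primal \<mu>)) = (SUP \<rho> \<in> radon_measures X. dual \<rho>)"
proof (rule antisym)
  show "(SUP \<rho> \<in> radon_measures X. dual \<rho>) \<le> (INF \<mu> \<in> radon_measures \<Omega>. ereal (primal \<mu>))"
    by (intro SUP_least INF_greatest weak_duality)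
  define p where "p = Inf (primal ` radon_measures \<Omega>)"
  have bdd: "bdd_below (primal ` radon_measures \<Omega>)" by (rule bdd_belowI2[of _ 0]) (rule primal_nonneg)
  have p_le: "p \<le> primal \<kappa>" if "\<kappa> \<in> radon_measures \<Omega>" for \<kappa>
    unfolding p_def using that by (intro cINF_lower[OF bdd])
  have p: "0 \<le> p" unfolding p_def by (intro cINF_greatest radon_measures_nonempty primal_nonneg)
  show "(INF \<mu> \<in> radon_measures \<Omega>. ereal (primal \<mu>)) \<le> (SUP \<rho> \<in> radon_measures X. dual \<rho>)"
  proof (rule ereal_le_epsilon2)
    fix e :: real assume e: "0 < e"
    \<comment> \<open>The error constant of \<open>near_optimal_dual\<close> at level
      \<open>p + 1\<close>. That level is admissible for every \<open>\<delta> \<le> 1\<close>, so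
      \<open>H\<close> is fixed before \<delta> is chosen and the choice \<open>e / H\<close> is not
      circular.\<close>
    define H where "H = 2 * (1 + C\<^sup>2 / 2) * (p + 1) + (1 + (C * (p + 1))\<^sup>2 / 2)"
    have H: "0 < H" unfolding H_def using p
      by (intro add_nonneg_pos mult_nonneg_nonneg add_pos_nonneg) auto
    define \<delta> where "\<delta> = min 1 (e / H)"
    have \<delta>: "0 < \<delta>" "\<delta> \<le> 1" "\<delta> * H \<le> e" using e H by (auto simp: \<delta>_def min_def field_simps)
    have "Inf (primal ` radon_measures \<Omega>) < p + \<delta>\<^sup>2" using \<delta>(1) by (simp add: p_def)
    then obtain \<mu> where \<mu>: "\<mu> \<in> radon_measures \<Omega>" "primal \<mu> < p + \<delta>\<^sup>2"
      using radon_measures_nonempty by (subst (asm) cINF_less_iff[OF _ bdd]) auto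
    have "primal \<mu> < primal \<kappa> + \<delta>\<^sup>2" if "\<kappa> \<in> radon_measures \<Omega>" for \<kappa>
      using \<mu>(2) p_le[OF that] by linarith
    moreover have "primal \<mu> \<le> p + 1" using \<mu>(2) \<delta> power_le_one[of \<delta> 2] by linarith
    ultimately obtain \<rho> where \<rho>: "\<rho> \<in> radon_measures X" "ereal (primal \<mu> - \<delta> * H) \<le> dual \<rho>"
      unfolding H_def using near_optimal_dual[OF \<mu>(1) \<delta>(1,2)] by metis
    have "(INF \<mu> \<in> radon_measures \<Omega>. ereal (primal \<mu>)) \<le> ereal (primal \<mu>)"
      using \<mu>(1) by (rule INF_lower)
    also have "\<dots> \<le> ereal (primal \<mu> - \<delta> * H) + ereal e" using \<delta>(3) by simp
    also have "\<dots> \<le> (SUP \<rho> \<in> radon_measures X. dual \<rho>) + ereal e"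
      by (intro add_right_mono SUP_upper2[OF \<rho>(1)] \<rho>(2))
    finally show "(INF \<mu> \<in> radon_measures \<Omega>. ereal (primal \<mu>)) \<le> (SUP \<rho> \<in> radon_measures X. dual \<rho>) + ereal e" .
  qed
qed

end

theorem theorem18:
  fixes X :: "(real ^ 'd) set" and \<Omega> :: "(real ^ 'D) set"
    and \<phi> :: "(real ^ 'd) \<times> (real ^ 'D) \<Rightarrow> real"
    and \<nu> :: "(real ^ 'd) measure" and y :: "real ^ 'd \<Rightarrow> real"
  assumes "closed X" and "closed \<Omega>"
    and "\<phi> \<in> C0 (X \<times> \<Omega>)"
    and "sets \<nu> = sets (borel_on X)" and "measure \<nu> \<in> radon_measures X" and "prob_space \<nu>"
    and "y \<in> borel_measurable \<nu>" and "integrable \<nu> (\<lambda>x. (y x)\<^sup>2)"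
  shows "(INF \<mu> \<in> radon_measures \<Omega>. ereal (J_fun \<nu> y (A_op X \<Omega> \<phi> \<mu>) + tv_norm \<Omega> \<mu>)) =
         (SUP \<rho> \<in> radon_measures X.
            - J_conj X \<Omega> \<phi> \<nu> y (\<lambda>E. - \<rho> E) - R_conj \<Omega> (A_adj X \<Omega> \<phi> \<rho>))
       \<and> is_perturbation_function X \<Omega> \<phi>
           (\<lambda>\<mu>. J_fun \<nu> y (A_op X \<Omega> \<phi> \<mu>) + tv_norm \<Omega> \<mu>)
           (\<lambda>\<rho>. - J_conj X \<Omega> \<phi> \<nu> y (\<lambda>E. - \<rho> E) - R_conj \<Omega> (A_adj X \<Omega> \<phi> \<rho>))
           (\<lambda>\<mu> f. J_fun \<nu> y (\<lambda>x. A_op X \<Omega> \<phi> \<mu> x - f x) + tv_norm \<Omega> \<mu>)"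
proof -
  obtain C where C: "0 \<le> C" "\<And>p. p \<in> X \<times> \<Omega> \<Longrightarrow> \<bar>\<phi> p\<bar> \<le> C"
    using C0_bounded[OF assms(3)] by blast
  interpret prob_space \<nu> by fact
  interpret regression X \<Omega> \<phi> C \<nu> y
    by standard (use assms C in \<open>auto simp: C0_def\<close>)
  show ?thesis
  proof
    show "(INF \<mu> \<in> radon_measures \<Omega>. ereal (J_fun \<nu> y (A_op X \<Omega> \<phi> \<mu>) + tv_norm \<Omega> \<mu>)) =
         (SUP \<rho> \<in> radon_measures X.
            - J_conj X \<Omega> \<phi> \<nu> y (\<lambda>E. - \<rho> E) - R_conj \<Omega> (A_adj X \<Omega> \<phi> \<rho>))"
      using strong_duality unfolding primal_def dual_def .
    show "is_perturbation_function X \<Omega> \<phi>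
           (\<lambda>\<mu>. J_fun \<nu> y (A_op X \<Omega> \<phi> \<mu>) + tv_norm \<Omega> \<mu>)
           (\<lambda>\<rho>. - J_conj X \<Omega> \<phi> \<nu> y (\<lambda>E. - \<rho> E) - R_conj \<Omega> (A_adj X \<Omega> \<phi> \<rho>))
           (\<lambda>\<mu> f. J_fun \<nu> y (\<lambda>x. A_op X \<Omega> \<phi> \<mu> x - f x) + tv_norm \<Omega> \<mu>)"
      unfolding is_perturbation_function_def
    proof (intro conjI ballI)
      fix \<rho> assume "\<rho> \<in> radon_measures X"
      from perturbation_conj_eq[OF this] dual_eq[of \<rho>]
      show "- J_conj X \<Omega> \<phi> \<nu> y (\<lambda>E. - \<rho> E) - R_conj \<Omega> (A_adj X \<Omega> \<phi> \<rho>) =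
        - perturbation_conj X \<Omega> \<phi> (\<lambda>\<mu> f. J_fun \<nu> y (\<lambda>x. A_op X \<Omega> \<phi> \<mu> x - f x) + tv_norm \<Omega> \<mu>) \<rho>"
        by (simp only: dual_def)
    qed simp
  qed
qed

end
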